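(* Let $\zeta$ be a rational critical point with denominator $q$, and let $w^\sigma(\ell)$, $\ell\geqslant0$, be the word of the $\ell$th curve adjacent to $\zeta$ in the quadrant $\sigma$. Let $u^+$ (resp. $u^-$) be the word of the positive (resp. negative) dominant curve of $\zeta$, and let $v^+$ (resp. $v^-$) be the word obtained by switching the first letter of $u^+$ (resp. $u^-$). Then $|u^+u^-|=|u^-u^+|=q$ and $$ w^\sigma(\ell)=\begin{cases} u^+\left(v^-u^+\right)^\ell & \sigma=\mathrm{I}\\ u^-\left(u^+v^-\right)^\ell & \sigma=\mathrm{II}\\ u^+\left(u^-v^+\right)^\ell & \sigma=\mathrm{III}\\ u^-\left(v^+u^-\right)^\ell & \sigma=\mathrm{IV} \end{cases} $$ for every quadrant $\sigma$ in which such curves exist (all four if $\rho\neq0,1$; only $\mathrm{I},\mathrm{II}$ can occur if $\rho=0$ and only $\mathrm{III},\mathrm{IV}$ if $\rho=1$).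
   Context: Rotation and coding. For $(\theta,\rho)\in[0,1]^2$ let $\mathrm{g}:[0,1)\to[0,1)$, $x\mapsto\{x+\theta\}$ ($\{\cdot\}$ = fractional part), with the partition $I_a=[0,\rho)$, $I_b=[\rho,1)$, which codes each orbit by letters $a,b$. In phase space the values $\theta=1$, $\rho=1$ are represented by their fractional part $0$. Critical points. $(\theta,\rho)\in[0,1]^2$ is a critical point if $i\theta=j+\rho$ for some $(i,j)\in\mathbb{Z}^2$. A rational critical point has the form $\zeta=(p/q,r/s)$ (fractions in lowest terms) with $s$ dividing $q$, and $q$ is called its denominator. Chains. For $(i,j)\in\mathbb{Z}^2$ with $0\leqslant j\leqslant i-1$ if $i>0$, $-1\leqslant j\leqslant 0$ if $i=0$, $i\leqslant j\leqslant -1$ if $i<0$, the chain with affine parameters $(i,j)$ is the segment $\mathcal{L}_{i,j}=\{(\theta,\rho)\in[0,1]^2: \rho=i\theta-j\}$. $\mathcal{L}_{0,0}$ is the segment $\rho=0$ and $\mathcal{L}_{0,-1}$ the segment $\rho=1$. A chain is positive if $i>0$, negative if $i<0$; for $i=0$ it is both. Critical words. The critical word at a point $(\theta,\rho)$ of $\mathcal{L}_{i,j}$ is: the empty word $\varepsilon$ if $\rho\in\{0,1\}$; if $\rho\neq0,1$ and $i>0$, the symbol sequence of the orbit starting at $0$ up to, but excluding, its first visit to $\rho$; if $\rho\neq 0,1$ and $i<0$, the symbol sequence of the orbit starting at $\rho$ up to, but excluding, its first visit to $0$. A chain is partitioned into maximal connected subsets on which the critical word is constant, called critical curves (if they have more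 than one point; the constant word is the word of the curve) or Farey points (if they are single points). Dominant objects. Let $\zeta=(p/q,\rho)$ be a rational critical point. If $\rho\neq0,1$, its dominant affine parameters are $(\mathbf{i}^+,\mathbf{j}^+)$, those of the chain $\mathcal L_{i,j}$ through $\zeta$ with $i>0$ minimal, and $(\mathbf{i}^-,\mathbf{j}^-)$, those of the chain through $\zeta$ with $i<0$ and $-i$ minimal. If $\rho=0$, $(\mathbf{i}^+,\mathbf{j}^+)=(0,0)$ and $(\mathbf{i}^-,\mathbf{j}^-)=(-q,-p)$. If $\rho=1$, $(\mathbf{i}^+,\mathbf{j}^+)=(q,p-1)$ and $(\mathbf{i}^-,\mathbf{j}^-)=(0,-1)$. The positive/negative dominant curve of $\zeta$ is the critical curve containing $\zeta$ on the chain $\mathcal{L}_{\mathbf{i}^\pm,\mathbf{j}^\pm}$ (or, when $\zeta$ is a Farey point of that chain, the curve on it whose closure contains $\zeta$). In the boundary cases the words are, by convention, $u^+=\varepsilon$, $u^-=b^q$ for $\rho=0$, and $u^+=a^q$, $u^-=\varepsilon$ for $\rho=1$. Curves in quadrants. The positive and negative chains through $\zeta$ are those with affine parameters $(\mathbf{i}^\pm\pm q\ell,\ \mathbf{j}^\pm\pm p\ell)$, $\ell=0,1,2,\ldots$ (with upper signs for positive and lower signs for negative; pairs violating the bounds on $j$ define no chain and are disregarded). Consider the four quadrants $\mathrm{I},\mathrm{II},\mathrm{III},\mathrm{IV}$ with origin at $\zeta$ in the $(\theta,\rho)$-plane. The $\ell$th curve adjacent to $\zeta$ in the quadrant $\sigma$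 is the critical curve, on the $\ell$th positive chain through $\zeta$ if $\sigma=\mathrm{I},\mathrm{III}$ and on the $\ell$th negative chain through $\zeta$ if $\sigma=\mathrm{II},\mathrm{IV}$, whose closure contains $\zeta$ and which contains points arbitrarily close to $\zeta$ with $\theta>p/q$ (for $\sigma=\mathrm{I},\mathrm{IV}$), respectively with $\theta<p/q$ (for $\sigma=\mathrm{II},\mathrm{III}$). For $\ell=0$ it is a dominant curve. Juxtaposition is concatenation, a power is repeated concatenation, $|\cdot|$ is length, and switching a letter exchanges $a$ and $b$.
   Formalization: The final restriction on quadrants is corrected: if ρ=0, the segment ρ=0 also counts as the curve with ℓ=0 in quadrant III, and if ρ=1, the segment ρ=1 as the curve with ℓ=0 in II; these are allowed as exceptions to "only I, II" and "only III, IV". *)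

theory Defs
  imports "HOL-Analysis.Analysis"
begin

datatype letter = La | Lb

definition rotation :: "real \<Rightarrow> real \<Rightarrow> real" where
  "rotation \<theta> x = frac (x + \<theta>)"

definition symbol :: "real \<Rightarrow> real \<Rightarrow> letter" where
  "symbol \<rho> x = (if 0 \<le> x \<and> x < \<rho> then La else Lb)"

definition first_visit :: "real \<Rightarrow> real \<Rightarrow> real \<Rightarrow> nat" where
  "first_visit \<theta> x y = (LEAST n. (rotation \<theta> ^^ n) x = y)"

text \<open>The symbol sequence of the orbit of \<open>x\<close> up to, but excluding, its first visit to \<open>y\<close>.
  It is meaningful only if the orbit of \<open>x\<close> does visit \<open>y\<close>.\<close>

definition itinerary :: "real \<Rightarrow> real \<Rightarrow> real \<Rightarrow> real \<Rightarrow> letter list" where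
  "itinerary \<theta> \<rho> x y = map (\<lambda>n. symbol \<rho> ((rotation \<theta> ^^ n) x)) [0..<first_visit \<theta> x y]"

text \<open>A point of parameter space is a pair \<open>(\<theta>, \<rho>)\<close>.\<close>

definition critical_point :: "real \<times> real \<Rightarrow> bool" where
  "critical_point = (\<lambda>(\<theta>, \<rho>). \<theta> \<in> {0..1} \<and> \<rho> \<in> {0..1} \<and>
     (\<exists>i j :: int. real_of_int i * \<theta> = real_of_int j + \<rho>))"

text \<open>The point \<open>(p/q, r/s)\<close>, both fractions being in lowest terms (so \<open>0 = 0/1\<close> and
  \<open>1 = 1/1\<close>); its denominator is \<open>q\<close>.\<close>

definition rational_critical_point :: "nat \<Rightarrow> nat \<Rightarrow> nat \<Rightarrow> nat \<Rightarrow> bool" where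
  "rational_critical_point p q r s \<longleftrightarrow>
     q > 0 \<and> s > 0 \<and> coprime p q \<and> coprime r s \<and> s dvd q \<and>
     critical_point (real p / real q, real r / real s)"

definition chain_params :: "int \<Rightarrow> int \<Rightarrow> bool" where
  "chain_params i j \<longleftrightarrow>
     (i > 0 \<and> 0 \<le> j \<and> j \<le> i - 1) \<or> (i = 0 \<and> -1 \<le> j \<and> j \<le> 0) \<or> (i < 0 \<and> i \<le> j \<and> j \<le> -1)"

definition chain :: "int \<Rightarrow> int \<Rightarrow> (real \<times> real) set" where
  "chain i j = {(\<theta>, \<rho>). \<theta> \<in> {0..1} \<and> \<rho> \<in> {0..1} \<and> \<rho> = real_of_int i * \<theta> - real_of_int j}"

text \<open>The critical word at a point of a chain depends only on the sign of \<open>i\<close>; on the two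
  chains with \<open>i = 0\<close> the first alternative always applies.\<close>

definition critical_word :: "int \<Rightarrow> real \<times> real \<Rightarrow> letter list" where
  "critical_word i = (\<lambda>(\<theta>, \<rho>).
     if \<rho> = 0 \<or> \<rho> = 1 then []
     else if i > 0 then itinerary \<theta> \<rho> 0 \<rho>
     else itinerary \<theta> \<rho> \<rho> 0)"

definition level_set :: "int \<Rightarrow> int \<Rightarrow> letter list \<Rightarrow> (real \<times> real) set" where
  "level_set i j w = {x \<in> chain i j. critical_word i x = w}"

text \<open>\<open>critical_curve i j C w\<close>: the set \<open>C\<close> is a critical curve on the chain with parameters
  \<open>(i, j)\<close>, and \<open>w\<close> is its word. The components of a set are its maximal connected (nonempty)
  subsets.\<close>

definition critical_curve :: "int \<Rightarrow> int \<Rightarrow> (real \<times> real) set \<Rightarrow> letter list \<Rightarrow> bool" where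
  "critical_curve i j C w \<longleftrightarrow>
     chain_params i j \<and> C \<in> components (level_set i j w) \<and> \<not> is_singleton C"

definition farey_point :: "int \<Rightarrow> int \<Rightarrow> real \<times> real \<Rightarrow> bool" where
  "farey_point i j x \<longleftrightarrow> chain_params i j \<and> (\<exists>w. {x} \<in> components (level_set i j w))"

text \<open>From here on the base point is \<open>\<zeta> = (p/q, \<rho>)\<close>.\<close>

definition base_point :: "nat \<Rightarrow> nat \<Rightarrow> real \<Rightarrow> real \<times> real" where
  "base_point p q \<rho> = (real p / real q, \<rho>)"

definition pos_dominant_params :: "nat \<Rightarrow> nat \<Rightarrow> real \<Rightarrow> int \<Rightarrow> int \<Rightarrow> bool" where
  "pos_dominant_params p q \<rho> i j \<longleftrightarrow>
     (if \<rho> = 0 then i = 0 \<and> j = 0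
      else if \<rho> = 1 then i = int q \<and> j = int p - 1
      else i > 0 \<and> chain_params i j \<and> base_point p q \<rho> \<in> chain i j \<and>
        (\<forall>i' j'. i' > 0 \<and> chain_params i' j' \<and> base_point p q \<rho> \<in> chain i' j' \<longrightarrow> i \<le> i'))"

definition neg_dominant_params :: "nat \<Rightarrow> nat \<Rightarrow> real \<Rightarrow> int \<Rightarrow> int \<Rightarrow> bool" where
  "neg_dominant_params p q \<rho> i j \<longleftrightarrow>
     (if \<rho> = 0 then i = - int q \<and> j = - int p
      else if \<rho> = 1 then i = 0 \<and> j = -1
      else i < 0 \<and> chain_params i j \<and> base_point p q \<rho> \<in> chain i j \<and>
        (\<forall>i' j'. i' < 0 \<and> chain_params i' j' \<and> base_point p q \<rho> \<in> chain i' j' \<longrightarrow> - i \<le> - i'))"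

definition dominant_on_chain ::
    "int \<Rightarrow> int \<Rightarrow> real \<times> real \<Rightarrow> (real \<times> real) set \<Rightarrow> letter list \<Rightarrow> bool" where
  "dominant_on_chain i j \<zeta> C w \<longleftrightarrow>
     critical_curve i j C w \<and> (\<zeta> \<in> C \<or> (farey_point i j \<zeta> \<and> \<zeta> \<in> closure C))"

text \<open>For \<open>\<rho> \<in> {0, 1}\<close> the dominant words are fixed by convention. This matters at the corners of
  the parameter square, where one of the dominant parameter pairs may not define a chain.\<close>

definition pos_dominant_word :: "nat \<Rightarrow> nat \<Rightarrow> real \<Rightarrow> letter list" where
  "pos_dominant_word p q \<rho> =
     (if \<rho> = 0 then []
      else if \<rho> = 1 then replicate q La
      else (THE w. \<exists>i j C. pos_dominant_params p q \<rho> i j \<and>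
              dominant_on_chain i j (base_point p q \<rho>) C w))"

definition neg_dominant_word :: "nat \<Rightarrow> nat \<Rightarrow> real \<Rightarrow> letter list" where
  "neg_dominant_word p q \<rho> =
     (if \<rho> = 0 then replicate q Lb
      else if \<rho> = 1 then []
      else (THE w. \<exists>i j C. neg_dominant_params p q \<rho> i j \<and>
              dominant_on_chain i j (base_point p q \<rho>) C w))"

datatype quadrant = QI | QII | QIII | QIV

definition chain_through :: "nat \<Rightarrow> nat \<Rightarrow> real \<Rightarrow> quadrant \<Rightarrow> nat \<Rightarrow> int \<Rightarrow> int \<Rightarrow> bool" where
  "chain_through p q \<rho> \<sigma> l i j \<longleftrightarrow>
     chain_params i j \<and>
     (if \<sigma> = QI \<or> \<sigma> = QIII
      then pos_dominant_params p q \<rho> (i - int q * int l) (j - int p * int l)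
      else neg_dominant_params p q \<rho> (i + int q * int l) (j + int p * int l))"

definition on_side :: "nat \<Rightarrow> nat \<Rightarrow> quadrant \<Rightarrow> real \<times> real \<Rightarrow> bool" where
  "on_side p q \<sigma> x \<longleftrightarrow>
     (if \<sigma> = QI \<or> \<sigma> = QIV then fst x > real p / real q else fst x < real p / real q)"

text \<open>\<open>adjacent_curve p q \<rho> \<sigma> l C w\<close>: \<open>C\<close> is the \<open>l\<close>th curve adjacent to \<open>(p/q, \<rho>)\<close> in the
  quadrant \<open>\<sigma>\<close>, and \<open>w\<close> is its word.\<close>

definition adjacent_curve ::
    "nat \<Rightarrow> nat \<Rightarrow> real \<Rightarrow> quadrant \<Rightarrow> nat \<Rightarrow> (real \<times> real) set \<Rightarrow> letter list \<Rightarrow> bool" where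
  "adjacent_curve p q \<rho> \<sigma> l C w \<longleftrightarrow>
     (\<exists>i j. chain_through p q \<rho> \<sigma> l i j \<and> critical_curve i j C w) \<and>
     base_point p q \<rho> \<in> closure C \<and>
     (\<forall>\<epsilon>>0. \<exists>x\<in>C. dist x (base_point p q \<rho>) < \<epsilon> \<and> on_side p q \<sigma> x)"

definition switch :: "letter \<Rightarrow> letter" where
  "switch x = (case x of La \<Rightarrow> Lb | Lb \<Rightarrow> La)"

text \<open>The empty word has no first letter and is left unchanged; this occurs only for a dominant
  word with \<open>\<rho> \<in> {0, 1}\<close>.\<close>

definition switch_first :: "letter list \<Rightarrow> letter list" where
  "switch_first w = (case w of [] \<Rightarrow> [] | x # xs \<Rightarrow> switch x # xs)"

definition word_power :: "letter list \<Rightarrow> nat \<Rightarrow> letter list" where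
  "word_power w l = concat (replicate l w)"

end

(*
  Write rho = k/q. Near zeta = (p/q, k/q), say at theta = p/q + delta, the n-th orbit point on a chain
  lies at distance less than 1/q from a point of the grid {0, 1/q, ..., (q-1)/q}, and so does rho.
  Hence a symbol is decided by comparing the residue n p mod q (plus an offset for orbits starting
  at rho) with k, and the sign of delta matters only when the residue is k or 0. These
  ambiguous positions recur with period q, which produces the powers; resolving them one way or the
  other is what switches the first letter of a dominant word.
*)
theory Submission
  imports Defs "HOL-Number_Theory.Cong"
begin

text \<open>Both dominant words come from one cycle. The chains through the base point have indices
  i with i p = k modulo q, and for coprime p and q these form one class modulo q. If I in [0, q]
  represents this class and 0 < k < q, the extreme indices are I and I - q, so the dominant words
  have lengths I and q - I. At \<theta> = p/q the orbit of \<rho> is the orbit of 0 entered at time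
  I. For k = 0 and k = q the class contains both 0 and q; choosing I = 0, respectively I = q,
  reproduces the boundary conventions, so the combinatorics need not treat them apart.

  A word is constant along its curve, so one point close to the base point and on the right side
  determines it; no endpoint of a curve is ever computed. Existence and the dominant words need
  more: constancy on a whole segment that ends at the base point or crosses it.\<close>

definition letter_of :: "bool \<Rightarrow> letter" where
  "letter_of b = (if b then La else Lb)"

lemma switch_letter_of [simp]: "switch (letter_of b) = letter_of (\<not> b)"
  by (simp add: switch_def letter_of_def)

section \<open>Words as maps over index intervals\<close>

lemma switch_first_map_upt:
  "switch_first (map f [a..<b]) = map (\<lambda>n. if n = a then switch (f n) else f n) [a..<b]"
  by (cases "a < b") (auto simp: switch_first_def upt_conv_Cons intro!: map_cong)

lemma word_power_0 [simp]: "word_power w 0 = []"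
  by (simp add: word_power_def)

lemma word_power_Suc_right: "word_power w (Suc l) = word_power w l @ w"
  by (induction l) (simp_all add: word_power_def)

text \<open>Periodicity is required only from b on, because in quadrants II and III the first
  occurrence of an ambiguous position is resolved differently from all later ones.\<close>

lemma map_upt_periodic:
  assumes "a \<le> b" and "\<And>n. b \<le> n \<Longrightarrow> f (n + q) = f n"
  shows "map f [a..<b + q * l] = map f [a..<b] @ word_power (map f [b..<b + q]) l"
proof (induction l)
  case 0
  then show ?case by simp
next
  case (Suc l)
  have shift: "f (n + q * m) = f n" if "b \<le> n" for n m
  proof (induction m)
    case (Suc m)
    have "f (n + q * Suc m) = f (n + q * m + q)" by (simp add: algebra_simps)
    also have "\<dots> = f n" using assms(2) [of "n + q * m"] that Suc by simp
    finally show ?case .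
  qed simp
  have "map f [a..<b + q * Suc l] = map f [a..<b + q * l] @ map f [b + q * l..<b + q * l + q]"
    using assms(1) upt_add_eq_append [of a "b + q * l" q] by (simp add: algebra_simps)
  also have "map f [b + q * l..<b + q * l + q] = map f [b..<b + q]"
    using shift [of "b + i" l for i] by (intro nth_equalityI) (auto simp: ac_simps)
  finally have "map f [a..<b + q * Suc l]
      = map f [a..<b] @ word_power (map f [b..<b + q]) l @ map f [b..<b + q]"
    using Suc by simp
  then show ?case by (simp add: word_power_Suc_right)
qed

section \<open>Fractional parts near the grid of multiples of 1/q\<close>

lemma frac_grid:
  fixes m q :: nat and e :: real
  assumes "q > 0" and "\<bar>e\<bar> < 1 / q"
  shows "frac (real m / real q + e) =
    (if e \<ge> 0 \<or> m mod q \<noteq> 0 then real (m mod q) / real q + e else 1 + e)"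
proof -
  have m: "real m / real q = real (m div q) + real (m mod q) / real q"
  proof -
    have "real m = real (m div q) * real q + real (m mod q)"
      by (metis div_mult_mod_eq of_nat_add of_nat_mult)
    then show ?thesis using assms(1) by (simp add: add_divide_distrib)
  qed
  have q1: "1 / real q \<le> 1" using assms(1) by simp
  have "m mod q + 1 \<le> q" using assms(1) by (simp add: Suc_leI)
  then have "real (m mod q + 1) / real q \<le> real q / real q"
    by (intro divide_right_mono) (auto simp only: of_nat_le_iff)
  then have up: "real (m mod q) / real q + 1 / real q \<le> 1"
    using assms(1) by (simp add: add_divide_distrib)
  show ?thesis
  proof (cases "e \<ge> 0 \<or> m mod q \<noteq> 0")
    case True
    have "0 \<le> real (m mod q) / real q + e"
    proof (cases "e \<ge> 0")
      case False
      with True have "1 / real q \<le> real (m mod q) / real q"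
        by (intro divide_right_mono) auto
      then show ?thesis using assms(2) by linarith
    qed simp
    then show ?thesis using True up assms(2) by (simp add: frac_unique_iff m)
  next
    \<comment> \<open>The only wraparound: a point pushed just below an integer reappears just below
      1. Later this is recorded as grid index q instead of 0.\<close>
    case False
    then have "real m / real q + e - (1 + e) = of_int (int (m div q) - 1)" by (simp add: m)
    then have "real m / real q + e - (1 + e) \<in> \<int>" by (metis Ints_of_int)
    with False q1 assms(2) show ?thesis by (simp add: frac_unique_iff)
  qed
qed

lemma grid_not_Ints:
  fixes m q :: nat and e :: real
  assumes "q > 0" "\<bar>e\<bar> < 1 / q" "e \<noteq> 0"
  shows "real m / real q + e \<notin> \<int>"
proof
  assume "real m / real q + e \<in> \<int>"
  then have "frac (real m / real q + e) = 0" by simp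
  then have *: "(if e \<ge> 0 \<or> m mod q \<noteq> 0 then real (m mod q) / real q + e else 1 + e) = 0"
    using frac_grid [OF assms(1,2), of m] by simp
  have "1 / real q \<le> 1" using assms(1) by simp
  moreover have "1 / real q \<le> real (m mod q) / real q" if "m mod q \<noteq> 0"
    using that by (intro divide_right_mono) auto
  ultimately show False
    using * assms(2,3) by (cases "m mod q = 0") (auto split: if_splits)
qed

section \<open>Itineraries of the rotation\<close>

lemma rotation_funpow:
  assumes "0 \<le> x" "x < 1"
  shows "(rotation \<theta> ^^ n) x = frac (x + real n * \<theta>)"
proof (induction n)
  case 0
  then show ?case using assms by (simp add: frac_eq)
next
  case (Suc n)
  have "frac (frac (x + real n * \<theta>) + \<theta>) = frac (x + real n * \<theta> + \<theta>)"
    by (simp add: frac_def algebra_simps)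
  then show ?case using Suc by (simp add: rotation_def algebra_simps)
qed

lemma itinerary_eq:
  assumes "0 \<le> x" "x < 1" and "frac (x + real N * \<theta>) = y"
    and "\<And>n. n < N \<Longrightarrow> frac (x + real n * \<theta>) \<noteq> y"
  shows "itinerary \<theta> \<rho> x y = map (\<lambda>n. letter_of (frac (x + real n * \<theta>) < \<rho>)) [0..<N]"
proof -
  have "first_visit \<theta> x y = N"
    unfolding first_visit_def
    by (rule Least_equality) (use assms in \<open>auto simp: rotation_funpow not_less [symmetric]\<close>)
  then show ?thesis
    using assms by (simp add: itinerary_def rotation_funpow symbol_def letter_of_def)
qed

text \<open>At time N the orbit is at \<rho>; an earlier visit at time n would make (N - n) \<theta>
  an integer. Excluding integer multiples of \<theta> up to N therefore makes N the first visit. The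
  same argument serves \<open>itinerary_neg\<close>, with target 0.\<close>

lemma itinerary_pos:
  fixes \<theta> \<rho> :: real and j :: int
  assumes "0 < \<rho>" "\<rho> < 1" and \<rho>: "\<rho> = real N * \<theta> - real_of_int j"
    and no: "\<And>c::nat. 0 < c \<Longrightarrow> c \<le> N \<Longrightarrow> real c * \<theta> \<notin> \<int>"
  shows "itinerary \<theta> \<rho> 0 \<rho> = map (\<lambda>n. letter_of (frac (real n * \<theta>) < \<rho>)) [0..<N]"
proof -
  have "frac (real N * \<theta>) = \<rho>"
    using assms(1,2) by (simp add: frac_unique_iff \<rho>)
  moreover have "frac (real n * \<theta>) \<noteq> \<rho>" if "n < N" for n
  proof
    assume "frac (real n * \<theta>) = \<rho>"
    then have "real n * \<theta> - \<rho> \<in> \<int>" using frac_unique_iff by blast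
    then have "of_int j - (real n * \<theta> - \<rho>) \<in> \<int>" by (rule Ints_diff [OF Ints_of_int])
    then have "real (N - n) * \<theta> \<in> \<int>" using that by (simp add: \<rho> of_nat_diff algebra_simps)
    with no [of "N - n"] that show False by simp
  qed
  ultimately show ?thesis using itinerary_eq [of 0 N \<theta> \<rho> \<rho>] by simp
qed

lemma itinerary_neg:
  fixes \<theta> \<rho> :: real and j :: int
  assumes "0 < \<rho>" "\<rho> < 1" and \<rho>: "\<rho> = - real N * \<theta> - real_of_int j"
    and no: "\<And>c::nat. 0 < c \<Longrightarrow> c \<le> N \<Longrightarrow> real c * \<theta> \<notin> \<int>"
  shows "itinerary \<theta> \<rho> \<rho> 0 = map (\<lambda>n. letter_of (frac (\<rho> + real n * \<theta>) < \<rho>)) [0..<N]"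
proof (rule itinerary_eq)
  show "frac (\<rho> + real N * \<theta>) = 0" by (simp add: \<rho>)
next
  fix n assume n: "n < N"
  show "frac (\<rho> + real n * \<theta>) \<noteq> 0"
  proof
    assume "frac (\<rho> + real n * \<theta>) = 0"
    then have "\<rho> + real n * \<theta> \<in> \<int>" by simp
    then have "- of_int j - (\<rho> + real n * \<theta>) \<in> \<int>" by (intro Ints_diff [OF Ints_minus [OF Ints_of_int]])
    then have "real (N - n) * \<theta> \<in> \<int>" using n by (simp add: \<rho> of_nat_diff algebra_simps)
    with no [of "N - n"] n show False by simp
  qed
qed (use assms in auto)

text \<open>Curves are produced from any connected piece of a level set: its component exists
  without being computed, and two distinct points keep it from being a singleton.\<close>

lemma critical_curve_superset:
  assumes "chain_params i j" "S \<subseteq> level_set i j w" "connected S" "x \<in> S" "y \<in> S" "x \<noteq> y"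
  obtains C where "critical_curve i j C w" "S \<subseteq> C"
proof -
  from assms obtain C where C: "C \<in> components (level_set i j w)" "S \<subseteq> C"
    using exists_component_superset [of S "level_set i j w"] by blast
  moreover have "\<not> is_singleton C"
    using C assms by (metis is_singletonE singletonD subset_iff)
  ultimately show thesis using that assms by (auto simp: critical_curve_def)
qed

text \<open>Distinct grid points are at least 1/q apart, so perturbations differing by less than
  that cannot reverse their order and matter only in a tie.\<close>

lemma grid_less_iff:
  fixes a b q :: nat and e1 e2 :: real
  assumes "q > 0" and "\<bar>e1 - e2\<bar> < 1 / q"
  shows "real a / q + e1 < real b / q + e2 \<longleftrightarrow> a < b \<or> (a = b \<and> e1 < e2)"
proof -
  have gap: "real m / q + 1 / q \<le> real n / q" if "m < n" for m n :: nat
  proof -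
    have "real (m + 1) \<le> real n" using that by linarith
    then have "real (m + 1) / q \<le> real n / q" using assms(1) by (intro divide_right_mono) auto
    then show ?thesis by (simp add: add_divide_distrib)
  qed
  consider "a < b" | "a = b" | "b < a" by linarith
  then show ?thesis
    by cases (use gap [of a b] gap [of b a] assms(2) in auto)
qed

text \<open>Ensures that \<open>critical_word\<close> is in its itinerary branch. For k = 0 or k = q
  the perturbation has to move the point off the border, hence the condition
  \<open>e \<noteq> 0\<close>.\<close>

lemma grid_in_unit_interval:
  fixes k q :: nat and e :: real
  assumes "q > 0" "k \<le> q" "\<bar>e\<bar> < 1 / q" and "e \<noteq> 0 \<or> (0 < k \<and> k < q)"
    and "0 \<le> real k / q + e" "real k / q + e \<le> 1"
  shows "0 < real k / q + e" and "real k / q + e < 1"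
proof -
  have q1: "1 / real q \<le> 1" using assms(1) by simp
  have one: "real q / q = 1" using assms(1) by simp
  show "0 < real k / q + e"
    using grid_less_iff [of q 0 e 0 k] assms by auto
  show "real k / q + e < 1"
    using grid_less_iff [of q e 0 k q] assms one by auto
qed

text \<open>The base point is \<open>(p/q, k/q)\<close>; \<open>(I, J)\<close> are its positive and \<open>(I - q, J - p)\<close> its negative
  dominant affine parameters, boundary conventions included.\<close>

locale critical_parameters =
  fixes p q k I :: nat and J :: int
  assumes q_pos: "q > 0" and p_le: "p \<le> q" and coprime: "coprime p q"
    and k_le: "k \<le> q" and I_le: "I \<le> q"
    and I_0: "I = 0 \<longleftrightarrow> k = 0" and I_q: "I = q \<longleftrightarrow> k = q"
    and IJ: "int I * int p = int k + J * int q"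
begin

section \<open>Residues of n p modulo q and the words read off them\<close>

lemma I_less: "k < q \<Longrightarrow> I < q"
  using I_le I_q by (metis le_neq_implies_less less_irrefl)

definition residue :: "nat \<Rightarrow> nat" where
  "residue n = n * p mod q"

text \<open>The words below are both read off the sequence \<open>residue 0, \<dots>, residue (q - 1)\<close>:
  since \<open>residue I = k\<close>, the orbit from \<open>\<rho>\<close> continues the orbit from \<open>0\<close>.
  At \<open>k = 0\<close> and \<open>k = q\<close> they specialise to the conventional dominant words.\<close>

definition u_plus :: "letter list" where
  "u_plus = map (\<lambda>n. letter_of (residue n < k)) [0..<I]"

definition u_minus :: "letter list" where
  "u_minus = map (\<lambda>n. letter_of (residue n < k)) [I..<q]"

lemma residue_less: "residue n < q"
  using q_pos by (simp add: residue_def)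

lemma residue_add_q [simp]: "residue (n + q) = residue n"
  by (simp add: residue_def distrib_right)

lemma residue_eq_0_iff: "residue n = 0 \<longleftrightarrow> q dvd n"
  using coprime by (simp add: residue_def mod_eq_0_iff_dvd coprime_commute coprime_dvd_mult_left_iff)

lemma residue_0 [simp]: "residue 0 = 0"
  by (simp add: residue_def)

lemma residue_pos: "0 < n \<Longrightarrow> n < q \<Longrightarrow> 0 < residue n"
  using residue_eq_0_iff [of n] by (auto dest: nat_dvd_not_less)

lemma residue_I: "k < q \<Longrightarrow> residue I = k"
proof -
  assume "k < q"
  have "int (residue I) = (int k + J * int q) mod int q"
    by (simp add: residue_def zmod_int IJ)
  also have "\<dots> = int k" using \<open>k < q\<close> by simp
  finally show ?thesis by simp
qed

text \<open>As p is invertible modulo q, each period contains exactly one time at which the orbit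
  ties with \<rho>.\<close>

lemma residue_eq_k_iff:
  assumes "n < q" "k < q"
  shows "residue n = k \<longleftrightarrow> n = I"
proof
  assume "residue n = k"
  then have "[n * p = I * p] (mod q)"
    using residue_I assms by (simp add: residue_def cong_def)
  then have "[n = I] (mod q)" using coprime by (simp add: cong_mult_rcancel_nat)
  then show "n = I" using assms I_less by (simp add: cong_def)
qed (use residue_I assms in simp)

lemma residue_le_k_iff: "n < q \<Longrightarrow> k < q \<Longrightarrow> residue n \<le> k \<longleftrightarrow> residue n < k \<or> n = I"
  using residue_eq_k_iff [of n] by auto

lemma length_u: "length u_plus + length u_minus = q"
  using I_le by (simp add: u_plus_def u_minus_def)

text \<open>Residue 0 occurs on [0, I) only at time 0, so switching the first letter amounts to
  counting residue 0 as b, that is, as a point that has wrapped to the top of the circle.\<close>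

lemma switch_first_u_plus:
  assumes "0 < k"
  shows "switch_first u_plus = map (\<lambda>n. letter_of (0 < residue n \<and> residue n < k)) [0..<I]"
  unfolding u_plus_def switch_first_map_upt
  by (rule map_cong) (use assms I_le residue_pos in auto)

text \<open>Residue k occurs on [I, q) only at time I, so switching the first letter amounts to
  resolving ties with \<rho> as a.\<close>

lemma switch_first_u_minus:
  assumes "k < q"
  shows "switch_first u_minus = map (\<lambda>n. letter_of (residue n \<le> k)) [I..<q]"
  unfolding u_minus_def switch_first_map_upt
  by (rule map_cong) (use assms residue_I residue_le_k_iff in \<open>auto intro!: arg_cong [of _ _ letter_of]\<close>)

section \<open>The four periodic patterns\<close>

lemma upt_split: "[I..<I + q] = [I..<q] @ [q..<q + I]" "[q..<q + q] = [q..<q + I] @ [q + I..<q + q]"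
  using I_le upt_add_eq_append [of I q I] upt_add_eq_append [of q "q + I" "q - I"]
  by (simp_all add: ac_simps)

text \<open>With \<open>upt_split\<close>, this cuts one period starting at I or at q into
  translates of the index ranges of the two dominant words.\<close>

lemma map_upt_shift:
  "map f [q..<q + I] = map (\<lambda>n. f (n + q)) [0..<I]"
  "map f [q + I..<q + q] = map (\<lambda>n. f (n + q)) [I..<q]"
  using I_le by (auto intro!: nth_equalityI simp: ac_simps)

text \<open>For \<theta> > p/q on a positive chain the orbit point lags behind \<rho>, so ties give
  a. Residue k is not met on [0, I), whence the prefix \<open>u_plus\<close>; each later pass over
  the times of \<open>u_minus\<close> begins with a tie and is switched.\<close>

lemma pattern_I:
  assumes "k < q"
  shows "map (\<lambda>n. letter_of (residue n \<le> k)) [0..<I + q * l]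
    = u_plus @ word_power (switch_first u_minus @ u_plus) l"
proof -
  have "map (\<lambda>n. letter_of (residue n \<le> k)) [0..<I] = u_plus"
    unfolding u_plus_def
    by (rule map_cong) (use assms I_less residue_le_k_iff in \<open>auto intro!: arg_cong [of _ _ letter_of]\<close>)
  then show ?thesis
    by (simp add: map_upt_periodic upt_split map_upt_shift switch_first_u_minus assms del: upt_Suc)
qed

text \<open>Time I is the starting point \<rho> itself, which is not below \<rho>: hence the
  exception \<open>n \<noteq> I\<close> and an unswitched first block. At later ties the point has
  moved to the left of \<rho>.\<close>

lemma pattern_II:
  assumes "k < q"
  shows "map (\<lambda>n. letter_of (residue n \<le> k \<and> n \<noteq> I)) [I..<q + q * l]
    = u_minus @ word_power (u_plus @ switch_first u_minus) l"
proof -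
  have "map (\<lambda>n. letter_of (residue n \<le> k \<and> n \<noteq> I)) [I..<q] = u_minus"
    unfolding u_minus_def
    by (rule map_cong) (use assms residue_I residue_le_k_iff in \<open>auto intro!: arg_cong [of _ _ letter_of]\<close>)
  moreover have "map (\<lambda>n. letter_of (residue n \<le> k \<and> n + q \<noteq> I)) [0..<I] = u_plus"
    unfolding u_plus_def
    by (rule map_cong) (use assms I_less residue_le_k_iff in \<open>auto intro!: arg_cong [of _ _ letter_of]\<close>)
  moreover have "map (\<lambda>n. letter_of (residue n \<le> k \<and> n + q \<noteq> I)) [I..<q] = switch_first u_minus"
    unfolding switch_first_u_minus [OF assms]
    by (rule map_cong) (use assms I_le in auto)
  ultimately show ?thesis
    using I_less [OF assms] map_upt_periodic [of I q "\<lambda>n. letter_of (residue n \<le> k \<and> n \<noteq> I)" q l]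
    by (simp add: upt_split map_upt_shift del: upt_Suc)
qed

text \<open>Time 0 is the point 0 itself, which does not move with \<theta>. At every later time of
  residue 0 the point has slipped below an integer and wraps, giving b.\<close>

lemma pattern_III:
  assumes "0 < k"
  shows "map (\<lambda>n. letter_of (n = 0 \<or> (0 < residue n \<and> residue n < k))) [0..<I + q * l]
    = u_plus @ word_power (u_minus @ switch_first u_plus) l"
proof -
  have "0 < I" using I_0 assms by simp
  have "map (\<lambda>n. letter_of (n = 0 \<or> (0 < residue n \<and> residue n < k))) [0..<I] = u_plus"
    unfolding u_plus_def
    by (rule map_cong) (use assms I_le residue_pos in \<open>auto intro!: arg_cong [of _ _ letter_of]\<close>)
  moreover have "map (\<lambda>n. letter_of (n = 0 \<or> (0 < residue n \<and> residue n < k))) [I..<q] = u_minus"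
    unfolding u_minus_def
    by (rule map_cong) (use assms \<open>0 < I\<close> residue_pos in \<open>auto intro!: arg_cong [of _ _ letter_of]\<close>)
  ultimately show ?thesis
    using \<open>0 < I\<close> q_pos
    by (simp add: map_upt_periodic upt_split map_upt_shift switch_first_u_plus assms del: upt_Suc)
qed

text \<open>Residue 0 first occurs at time q, where the point is already displaced downwards and
  wraps. Ties give b: at time I the point is \<rho>, later it lies to its right.\<close>

lemma pattern_IV:
  assumes "0 < k"
  shows "map (\<lambda>n. letter_of (0 < residue n \<and> residue n < k)) [I..<q + q * l]
    = u_minus @ word_power (switch_first u_plus @ u_minus) l"
proof -
  have "0 < I" using I_0 assms by simp
  then have "map (\<lambda>n. letter_of (0 < residue n \<and> residue n < k)) [I..<q] = u_minus"
    unfolding u_minus_def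
    by (intro map_cong) (use residue_pos in \<open>auto intro!: arg_cong [of _ _ letter_of]\<close>)
  then show ?thesis
    using I_le
    by (simp add: map_upt_periodic upt_split map_upt_shift switch_first_u_plus assms del: upt_Suc)
qed

section \<open>Chains through the base point and their orbits nearby\<close>

lemma multiple_not_Ints:
  assumes "0 < c" "c \<le> N" and "real N * \<bar>\<theta> - p / q\<bar> < 1 / q" and "\<theta> \<noteq> p / q \<or> N < q"
  shows "real c * \<theta> \<notin> \<int>"
proof -
  have *: "real c * \<theta> = real (c * p) / q + real c * (\<theta> - p / q)"
    by (simp add: algebra_simps)
  have "real c * \<bar>\<theta> - p / q\<bar> \<le> real N * \<bar>\<theta> - p / q\<bar>"
    using assms(2) by (intro mult_right_mono) auto
  then have small: "\<bar>real c * (\<theta> - p / q)\<bar> < 1 / q" using assms(3) by (simp add: abs_mult)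
  \<comment> \<open>At \<theta> = p/q the multiples below q are not integers by coprimality. For
    other \<theta> the perturbation is nonzero and smaller than a grid step, which settles multiples
    of q as well.\<close>
  show ?thesis
  proof (cases "\<theta> = p / q")
    case True
    then have "frac (real c * \<theta>) = real (residue c) / q"
      using frac_grid [of q 0 "c * p"] q_pos * by (simp add: residue_def)
    moreover have "residue c \<noteq> 0" using residue_pos [of c] True assms by simp
    ultimately have "frac (real c * \<theta>) \<noteq> 0" using q_pos by simp
    then show ?thesis by simp
  next
    case False
    then show ?thesis
      unfolding * using assms(1) small q_pos by (intro grid_not_Ints) auto
  qed
qed

abbreviation pos_chain :: "nat \<Rightarrow> (real \<times> real) set" where
  "pos_chain l \<equiv> chain (int (I + q * l)) (J + int p * int l)"

text \<open>The index is written as minus a natural number, because that number is the length of the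
  critical word near the base point.\<close>

abbreviation neg_chain :: "nat \<Rightarrow> (real \<times> real) set" where
  "neg_chain l \<equiv> chain (- int (q - I + q * l)) (J - int p - int p * int l)"

lemma IJ_real: "real I * real p = real k + of_int J * real q"
  using arg_cong [OF IJ, of real_of_int] by simp

lemma pos_line:
  "real (I + q * l) * \<theta> - real_of_int (J + int p * int l)
    = real k / q + real (I + q * l) * (\<theta> - p / q)"
  using IJ_real q_pos by (simp add: field_simps)

lemma neg_line:
  "- real (q - I + q * l) * \<theta> - real_of_int (J - int p - int p * int l)
    = real k / q - real (q - I + q * l) * (\<theta> - p / q)"
  using IJ_real q_pos I_le by (simp add: field_simps of_nat_diff)

lemma pos_chain_iff:
  "(\<theta>, \<rho>) \<in> pos_chain l \<longleftrightarrow> \<theta> \<in> {0..1} \<and> \<rho> \<in> {0..1}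
    \<and> \<rho> = real k / q + real (I + q * l) * (\<theta> - p / q)"
  using pos_line [of l \<theta>] by (simp add: chain_def del: of_nat_add of_nat_mult of_int_add of_int_mult)

lemma neg_chain_iff:
  "(\<theta>, \<rho>) \<in> neg_chain l \<longleftrightarrow> \<theta> \<in> {0..1} \<and> \<rho> \<in> {0..1}
    \<and> \<rho> = real k / q - real (q - I + q * l) * (\<theta> - p / q)"
  using neg_line [of l \<theta>]
  by (simp add: chain_def del: of_nat_add of_nat_mult of_int_add of_int_mult of_int_diff)

lemma critical_word_pos:
  assumes x: "(\<theta>, \<rho>) \<in> pos_chain l"
    and small: "real (I + q * l) * \<bar>\<theta> - p / q\<bar> < 1 / q"
    and \<theta>: "\<theta> \<noteq> p / q \<or> (l = 0 \<and> 0 < k \<and> k < q)"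
  shows "critical_word (int (I + q * l)) (\<theta>, \<rho>)
    = map (\<lambda>n. letter_of (frac (real n * \<theta>) < \<rho>)) [0..<I + q * l]"
proof (cases "I + q * l = 0")
  \<comment> \<open>This is the chain \<rho> = 0, where the default empty word agrees with the map
    over the empty interval.\<close>
  case True
  then have "\<rho> = 0" using x [unfolded pos_chain_iff] I_0 by auto
  with True show ?thesis by (simp add: critical_word_def)
next
  case False
  note \<rho> = x [unfolded pos_chain_iff]
  from \<theta> I_less have \<theta>': "\<theta> \<noteq> p / q \<or> I + q * l < q" by auto
  have "0 < \<rho>" "\<rho> < 1"
    using grid_in_unit_interval [of q k "real (I + q * l) * (\<theta> - p / q)"] False \<theta> q_pos k_le small \<rho>
    by (auto simp: abs_mult simp del: of_nat_add of_nat_mult)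
  moreover have "\<rho> = real (I + q * l) * \<theta> - real_of_int (J + int p * int l)"
    using \<rho> pos_line by simp
  ultimately show ?thesis
    using itinerary_pos [OF _ _ _ multiple_not_Ints [OF _ _ small \<theta>']] False
    by (simp add: critical_word_def del: of_nat_add of_nat_mult of_int_add of_int_mult)
qed

lemma critical_word_neg:
  assumes x: "(\<theta>, \<rho>) \<in> neg_chain l"
    and small: "real (q - I + q * l) * \<bar>\<theta> - p / q\<bar> < 1 / q"
    and \<theta>: "\<theta> \<noteq> p / q \<or> (l = 0 \<and> 0 < k \<and> k < q)"
  shows "critical_word (- int (q - I + q * l)) (\<theta>, \<rho>)
    = map (\<lambda>n. letter_of (frac (\<rho> + real n * \<theta>) < \<rho>)) [0..<q - I + q * l]"
proof (cases "q - I + q * l = 0")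
  case True
  then have "k = q" using I_q I_le by auto
  then have "\<rho> = 1" using x [unfolded neg_chain_iff] True q_pos by auto
  with True show ?thesis by (simp add: critical_word_def)
next
  case False
  note \<rho> = x [unfolded neg_chain_iff]
  have "0 < I" if "0 < k" using that I_0 by simp
  with \<theta> q_pos have \<theta>': "\<theta> \<noteq> p / q \<or> q - I + q * l < q" by auto
  have "0 < \<rho>" "\<rho> < 1"
    using grid_in_unit_interval [of q k "- (real (q - I + q * l) * (\<theta> - p / q))"]
      False \<theta> q_pos k_le small \<rho>
    by (auto simp: abs_mult simp del: of_nat_add of_nat_mult)
  moreover have "\<rho> = - real (q - I + q * l) * \<theta> - real_of_int (J - int p - int p * int l)"
    using \<rho> neg_line by simp
  ultimately show ?thesis
    using itinerary_neg [OF _ _ _ multiple_not_Ints [OF _ _ small \<theta>']] False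
    by (simp add: critical_word_def del: of_nat_add of_nat_mult of_int_add of_int_mult of_int_diff)
qed

text \<open>With \<delta> = \<theta> - p/q, the point \<rho> is displaced by N \<delta> and the n-th
  orbit point by n \<delta>. The difference (N - n) \<delta> is below one grid step and has the sign
  of \<delta>, so \<open>grid_less_iff\<close> applies and the sign of \<delta> decides
  ties.\<close>

lemma pos_orbit_less_iff:
  assumes \<rho>: "\<rho> = real k / q + real N * (\<theta> - p / q)"
    and small: "real N * \<bar>\<theta> - p / q\<bar> < 1 / q" and "n < N"
  shows "frac (real n * \<theta>) < \<rho> \<longleftrightarrow>
    (let a = if 0 \<le> real n * (\<theta> - p / q) \<or> residue n \<noteq> 0 then residue n else q
     in a < k \<or> (a = k \<and> p / q < \<theta>))"
proof -
  define e E where "e = real n * (\<theta> - p / q)" and "E = real N * (\<theta> - p / q)"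
  have le: "real c * \<bar>\<theta> - p / q\<bar> < 1 / q" if "c \<le> N" for c
    using mult_right_mono [of "real c" "real N" "\<bar>\<theta> - p / q\<bar>"] that small by linarith
  have d: "E - e = real (N - n) * (\<theta> - p / q)"
    using \<open>n < N\<close> by (simp add: e_def E_def of_nat_diff left_diff_distrib)
  have "\<bar>E - e\<bar> < 1 / q" unfolding d using le [of "N - n"] by (simp add: abs_mult)
  then have eE: "\<bar>e - E\<bar> < 1 / q" by (simp add: abs_minus_commute)
  have "0 < E - e \<longleftrightarrow> p / q < \<theta>" unfolding d using \<open>n < N\<close> by (simp add: zero_less_mult_iff)
  then have sgn: "e < E \<longleftrightarrow> p / q < \<theta>" by simp
  have "\<bar>e\<bar> < 1 / q" using le [of n] \<open>n < N\<close> by (simp add: e_def abs_mult)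
  then have "frac (real (n * p) / q + e) = real (if 0 \<le> e \<or> residue n \<noteq> 0 then residue n else q) / q + e"
    using frac_grid [OF q_pos, of e "n * p"] q_pos by (simp add: residue_def)
  moreover have "real n * \<theta> = real (n * p) / q + e" by (simp add: e_def algebra_simps)
  moreover have "\<rho> = real k / q + E" by (simp add: \<rho> E_def)
  ultimately have "frac (real n * \<theta>) < \<rho> \<longleftrightarrow>
      real (if 0 \<le> e \<or> residue n \<noteq> 0 then residue n else q) / q + e < real k / q + E"
    by (simp only:)
  then show ?thesis
    by (simp only: grid_less_iff [OF q_pos eE] sgn Let_def flip: e_def)
qed

text \<open>With \<delta> = \<theta> - p/q, now \<rho> is displaced by - N \<delta> and the n-th
  orbit point by (n - N) \<delta>. Their difference n \<delta> decides ties and vanishes at the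
  start of the orbit, while the sign of - \<delta> decides wrapping.\<close>

lemma neg_orbit_less_iff:
  assumes \<rho>: "\<rho> = real k / q - real N * (\<theta> - p / q)"
    and small: "real N * \<bar>\<theta> - p / q\<bar> < 1 / q" and "n < N"
  shows "frac (\<rho> + real n * \<theta>) < \<rho> \<longleftrightarrow>
    (let a = if \<theta> \<le> p / q \<or> residue (I + n) \<noteq> 0 then residue (I + n) else q
     in a < k \<or> (a = k \<and> real n * (\<theta> - p / q) < 0))"
proof -
  define e E where "e = real n * (\<theta> - p / q) - real N * (\<theta> - p / q)"
    and "E = - real N * (\<theta> - p / q)"
  have le: "real c * \<bar>\<theta> - p / q\<bar> < 1 / q" if "c \<le> N" for c
    using mult_right_mono [of "real c" "real N" "\<bar>\<theta> - p / q\<bar>"] that small by linarith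
  have eE: "\<bar>e - E\<bar> < 1 / q" and less: "e < E \<longleftrightarrow> real n * (\<theta> - p / q) < 0"
    using le [of n] \<open>n < N\<close> by (simp_all add: e_def E_def abs_mult)
  have "e = real (N - n) * (p / q - \<theta>)"
    using \<open>n < N\<close> by (simp add: e_def of_nat_diff algebra_simps diff_divide_distrib)
  then have e: "\<bar>e\<bar> < 1 / q" and sgn: "0 \<le> e \<longleftrightarrow> \<theta> \<le> p / q"
    using le [of "N - n"] \<open>n < N\<close> by (auto simp: abs_mult abs_minus_commute zero_le_mult_iff)
  \<comment> \<open>Adding the integer J turns k/q into I p / q, so the orbit of \<rho> is indexed
    as the orbit of 0 from time I on.\<close>
  have "\<rho> + real n * \<theta> + of_int J = real ((I + n) * p) / q + e"
    using IJ_real q_pos by (simp add: \<rho> e_def field_simps)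
  then have "frac (\<rho> + real n * \<theta>) = frac (real ((I + n) * p) / q + e)"
    by (metis frac_add_of_int_right)
  then have "frac (\<rho> + real n * \<theta>)
      = real (if 0 \<le> e \<or> residue (I + n) \<noteq> 0 then residue (I + n) else q) / q + e"
    using frac_grid [OF q_pos e, of "(I + n) * p"] q_pos by (simp add: residue_def)
  moreover have "\<rho> = real k / q + E" by (simp add: \<rho> E_def)
  ultimately have "frac (\<rho> + real n * \<theta>) < \<rho> \<longleftrightarrow>
      real (if 0 \<le> e \<or> residue (I + n) \<noteq> 0 then residue (I + n) else q) / q + e < real k / q + E"
    by (simp only:)
  then show ?thesis
    unfolding grid_less_iff [OF q_pos eE] sgn less Let_def .
qed

section \<open>Critical words near the base point, quadrant by quadrant\<close>

lemma word_I:
  assumes x: "(\<theta>, \<rho>) \<in> pos_chain l"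
    and small: "real (I + q * l) * \<bar>\<theta> - p / q\<bar> < 1 / q" and "\<theta> > p / q"
  shows "critical_word (int (I + q * l)) (\<theta>, \<rho>)
    = u_plus @ word_power (switch_first u_minus @ u_plus) l"
proof -
  note \<rho> = x [unfolded pos_chain_iff]
  \<comment> \<open>From \<rho> = 1 a line of positive slope would leave the unit square to the
    right.\<close>
  have "k < q"
  proof (rule ccontr)
    assume "\<not> k < q"
    then have "k = q" "I = q" using k_le I_q by auto
    then have "0 < real (I + q * l) * (\<theta> - p / q)" using q_pos assms(3) by (intro mult_pos_pos) (auto simp del: of_nat_add of_nat_mult)
    with \<rho> \<open>k = q\<close> q_pos show False by simp
  qed
  have "frac (real n * \<theta>) < \<rho> \<longleftrightarrow> residue n \<le> k" if "n < I + q * l" for n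
    using pos_orbit_less_iff [OF conjunct2 [OF conjunct2 [OF \<rho>]] small that] assms(3)
    by (auto simp: Let_def le_less [of "residue n" k])
  then have "map (\<lambda>n. letter_of (frac (real n * \<theta>) < \<rho>)) [0..<I + q * l]
      = map (\<lambda>n. letter_of (residue n \<le> k)) [0..<I + q * l]" by simp
  then show ?thesis
    using critical_word_pos [OF x small] assms(3) pattern_I [OF \<open>k < q\<close>] by simp
qed

lemma word_III:
  assumes x: "(\<theta>, \<rho>) \<in> pos_chain l"
    and small: "real (I + q * l) * \<bar>\<theta> - p / q\<bar> < 1 / q" and "\<theta> < p / q"
  shows "critical_word (int (I + q * l)) (\<theta>, \<rho>)
    = u_plus @ word_power (u_minus @ switch_first u_plus) l"
proof (cases "k = 0")
  case True
  note \<rho> = x [unfolded pos_chain_iff]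
  have "I = 0" using True I_0 by simp
  \<comment> \<open>From \<rho> = 0 a line of positive slope would leave the square to the left.
    Only the horizontal chain remains, with empty word.\<close>
  have "l = 0"
  proof (rule ccontr)
    assume "l \<noteq> 0"
    then have "real (I + q * l) * (\<theta> - p / q) < 0"
      using q_pos assms(3) by (intro mult_pos_neg) (auto simp del: of_nat_add of_nat_mult)
    with \<rho> True show False by simp
  qed
  then show ?thesis
    using critical_word_pos [OF x small] assms(3) \<open>I = 0\<close> \<open>l = 0\<close> u_plus_def by simp
next
  case False
  note \<rho> = x [unfolded pos_chain_iff]
  have "frac (real n * \<theta>) < \<rho> \<longleftrightarrow> n = 0 \<or> (0 < residue n \<and> residue n < k)" if "n < I + q * l" for n
    using pos_orbit_less_iff [OF conjunct2 [OF conjunct2 [OF \<rho>]] small that] assms(3) False k_le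
    by (cases "n = 0") (auto simp: Let_def zero_le_mult_iff)
  then have "map (\<lambda>n. letter_of (frac (real n * \<theta>) < \<rho>)) [0..<I + q * l]
      = map (\<lambda>n. letter_of (n = 0 \<or> (0 < residue n \<and> residue n < k))) [0..<I + q * l]" by simp
  then show ?thesis
    using critical_word_pos [OF x small] assms(3) pattern_III False by simp
qed

lemma map_shift_I: "map (\<lambda>n. f (I + n)) [0..<q - I + q * l] = map f [I..<q + q * l]"
  using I_le by (intro nth_equalityI) auto

lemma word_IV:
  assumes x: "(\<theta>, \<rho>) \<in> neg_chain l"
    and small: "real (q - I + q * l) * \<bar>\<theta> - p / q\<bar> < 1 / q" and "\<theta> > p / q"
  shows "critical_word (- int (q - I + q * l)) (\<theta>, \<rho>)
    = u_minus @ word_power (switch_first u_plus @ u_minus) l"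
proof -
  note \<rho> = x [unfolded neg_chain_iff]
  \<comment> \<open>From \<rho> = 0 a line of negative slope would leave the square to the
    right.\<close>
  have "0 < k"
  proof (rule ccontr)
    assume "\<not> 0 < k"
    then have "k = 0" "I = 0" using I_0 by auto
    then have "0 < real (q - I + q * l) * (\<theta> - p / q)" using q_pos assms(3) by (intro mult_pos_pos) (auto simp del: of_nat_add of_nat_mult)
    with \<rho> \<open>k = 0\<close> show False by simp
  qed
  have "frac (\<rho> + real n * \<theta>) < \<rho> \<longleftrightarrow> 0 < residue (I + n) \<and> residue (I + n) < k"
    if "n < q - I + q * l" for n
    using neg_orbit_less_iff [OF conjunct2 [OF conjunct2 [OF \<rho>]] small that] assms(3) k_le
    by (auto simp: Let_def mult_less_0_iff)
  then have "map (\<lambda>n. letter_of (frac (\<rho> + real n * \<theta>) < \<rho>)) [0..<q - I + q * l]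
      = map (\<lambda>n. letter_of (0 < residue (I + n) \<and> residue (I + n) < k)) [0..<q - I + q * l]"
    by simp
  then show ?thesis
    using critical_word_neg [OF x small] assms(3) pattern_IV [OF \<open>0 < k\<close>]
      map_shift_I [of "\<lambda>n. letter_of (0 < residue n \<and> residue n < k)"] by simp
qed

lemma word_II:
  assumes x: "(\<theta>, \<rho>) \<in> neg_chain l"
    and small: "real (q - I + q * l) * \<bar>\<theta> - p / q\<bar> < 1 / q" and "\<theta> < p / q"
  shows "critical_word (- int (q - I + q * l)) (\<theta>, \<rho>)
    = u_minus @ word_power (u_plus @ switch_first u_minus) l"
proof (cases "k = q")
  case True
  note \<rho> = x [unfolded neg_chain_iff]
  have "I = q" using True I_q by simp
  \<comment> \<open>From \<rho> = 1 only the horizontal chain stays in the square to the left, again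
    with empty word.\<close>
  have "l = 0"
  proof (rule ccontr)
    assume "l \<noteq> 0"
    then have "real (q - I + q * l) * (\<theta> - p / q) < 0"
      using q_pos assms(3) by (intro mult_pos_neg) (auto simp del: of_nat_add of_nat_mult)
    with \<rho> True q_pos show False by simp
  qed
  then show ?thesis
    using critical_word_neg [OF x small] assms(3) \<open>I = q\<close> \<open>l = 0\<close> u_minus_def by simp
next
  case False
  then have "k < q" using k_le by simp
  note \<rho> = x [unfolded neg_chain_iff]
  have "frac (\<rho> + real n * \<theta>) < \<rho> \<longleftrightarrow> residue (I + n) \<le> k \<and> I + n \<noteq> I"
    if "n < q - I + q * l" for n
    using neg_orbit_less_iff [OF conjunct2 [OF conjunct2 [OF \<rho>]] small that] assms(3)
      residue_I [OF \<open>k < q\<close>]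
    by (cases "n = 0")
      (simp_all add: Let_def mult_less_0_iff le_less [of "residue (I + n)" k])
  then have "map (\<lambda>n. letter_of (frac (\<rho> + real n * \<theta>) < \<rho>)) [0..<q - I + q * l]
      = map (\<lambda>n. letter_of (residue (I + n) \<le> k \<and> I + n \<noteq> I)) [0..<q - I + q * l]"
    by (intro map_cong) auto
  also have "\<dots> = u_minus @ word_power (u_plus @ switch_first u_minus) l"
    unfolding map_shift_I [of "\<lambda>n. letter_of (residue n \<le> k \<and> n \<noteq> I)"]
    by (rule pattern_II [OF \<open>k < q\<close>])
  finally show ?thesis using critical_word_neg [OF x small] assms(3) by simp
qed

text \<open>The base point carries the same word as its neighbours on the dominant chain, so it lies
  on the dominant curve and is not a Farey point of that chain.\<close>

lemma word_base_pos:
  assumes "0 < k" "k < q" and x: "(p / q, \<rho>) \<in> pos_chain 0"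
  shows "critical_word (int I) (p / q, \<rho>) = u_plus"
proof -
  note \<rho> = x [unfolded pos_chain_iff]
  have "frac (real n * (p / q)) < \<rho> \<longleftrightarrow> residue n < k" if "n < I" for n
    using pos_orbit_less_iff [of \<rho> I "p / q" n] that \<rho> q_pos by simp
  then have "map (\<lambda>n. letter_of (frac (real n * (p / q)) < \<rho>)) [0..<I] = u_plus"
    by (simp add: u_plus_def)
  then show ?thesis using critical_word_pos [OF x] assms q_pos by simp
qed

lemma word_base_neg:
  assumes "0 < k" "k < q" and x: "(p / q, \<rho>) \<in> neg_chain 0"
  shows "critical_word (- int (q - I)) (p / q, \<rho>) = u_minus"
proof -
  note \<rho> = x [unfolded neg_chain_iff]
  have "frac (\<rho> + real n * (p / q)) < \<rho> \<longleftrightarrow> residue (I + n) < k" if "n < q - I" for n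
    using neg_orbit_less_iff [of \<rho> "q - I" "p / q" n] that \<rho> q_pos by simp
  then have "map (\<lambda>n. letter_of (frac (\<rho> + real n * (p / q)) < \<rho>)) [0..<q - I]
      = map (\<lambda>n. letter_of (residue (I + n) < k)) [0..<q - I]"
    by (intro map_cong) auto
  also have "\<dots> = u_minus"
    using map_shift_I [of "\<lambda>n. letter_of (residue n < k)" 0] by (simp add: u_minus_def)
  finally have "map (\<lambda>n. letter_of (frac (\<rho> + real n * (p / q)) < \<rho>)) [0..<q - I] = u_minus" .
  then show ?thesis using critical_word_neg [OF x] assms q_pos by simp
qed

section \<open>The dominant affine parameters\<close>

lemma J_0: "k = 0 \<Longrightarrow> J = 0"
  using IJ I_0 q_pos by simp

lemma J_q: "k = q \<Longrightarrow> J = int p - 1"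
proof -
  assume "k = q"
  then have "int q * int p = int q * (J + 1)" using IJ I_q by (simp add: algebra_simps)
  then show ?thesis using q_pos by simp
qed

lemma base_point_in_chain_iff:
  "base_point p q (k / q) \<in> chain i j \<longleftrightarrow> i * int p = int k + j * int q"
proof -
  have "real k / q = of_int i * (p / q) - of_int j \<longleftrightarrow> real k = of_int i * real p - of_int j * real q"
    using q_pos by (auto simp: field_simps)
  also have "\<dots> \<longleftrightarrow> i * int p = int k + j * int q"
  proof -
    have "real k = of_int i * real p - of_int j * real q \<longleftrightarrow>
        real_of_int (int k) = real_of_int (i * int p - j * int q)" by simp
    also have "\<dots> \<longleftrightarrow> i * int p = int k + j * int q" unfolding of_int_eq_iff by auto
    finally show ?thesis .
  qed
  finally show ?thesis using q_pos p_le k_le by (simp add: base_point_def chain_def)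
qed

text \<open>Cancelling the unit p modulo q. For 0 < I < q this makes I the least positive index of a
  chain through the base point and I - q the negative one closest to 0.\<close>

lemma base_line_cong:
  assumes "i * int p = int k + j * int q"
  shows "int q dvd i - int I"
proof -
  have "(i - int I) * int p = (j - J) * int q" using assms IJ by (simp add: algebra_simps)
  then have "int q dvd (i - int I) * int p" by simp
  then show ?thesis using coprime by (simp add: coprime_commute coprime_dvd_mult_left_iff)
qed

lemma J_unique: "int I * int p = int k + j * int q \<Longrightarrow> j = J"
  using IJ q_pos by simp

context
  assumes k_pos: "0 < k" and k_less: "k < q"
begin

lemma I_pos: "0 < I"
  using I_0 k_pos by simp

lemma p_pos: "0 < p"
proof (rule ccontr)
  assume "\<not> 0 < p"
  then have "q = 1" using coprime by simp
  then show False using k_pos k_less by simp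
qed

lemma p_less: "p < q"
proof (rule ccontr)
  assume "\<not> p < q"
  then have "p = q" using p_le by simp
  then have "q = 1" using coprime by simp
  then show False using k_pos k_less by simp
qed

lemma J_bounds: "0 \<le> J" "J \<le> int I - 1" "J \<le> int p - 1" "int I - int q \<le> J - int p"
proof -
  have "0 \<le> int I * int p" by simp
  then have "0 < (J + 1) * int q" using IJ k_less by (simp add: algebra_simps)
  then show "0 \<le> J" using q_pos by (simp add: zero_less_mult_iff)
  have "int I * int p \<le> int I * int q" using p_le by (intro mult_left_mono) auto
  then have "J * int q < int I * int q" using IJ k_pos by linarith
  then show "J \<le> int I - 1" using q_pos by simp
  have "int I * int p \<le> int q * int p" using I_le by (intro mult_right_mono) auto
  then have "J * int q < int p * int q" using IJ k_pos by (simp add: algebra_simps)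
  then show "J \<le> int p - 1" using q_pos by simp
  \<comment> \<open>By \<open>IJ\<close>, the product below with factor q equals (q - I)(q - p) + (q
    - k), which is positive.\<close>
  have "0 \<le> (int q - int I) * (int q - int p)" using I_le p_le by simp
  then have "0 < (J - int p - int I + int q + 1) * int q" using IJ k_less by (simp add: algebra_simps)
  then have "0 < J - int p - int I + int q + 1" using q_pos by (simp add: zero_less_mult_iff)
  then show "int I - int q \<le> J - int p" by linarith
qed

lemma chain_params_pos: "chain_params (int (I + q * l)) (J + int p * int l)"
proof -
  have "int p * int l \<le> int q * int l" using p_le by (intro mult_right_mono) auto
  moreover have "0 \<le> int p * int l" by simp
  moreover have "0 < int I" using I_pos by simp
  moreover have "0 \<le> int q * int l" by simp
  ultimately show ?thesis
    using J_bounds unfolding chain_params_def of_nat_add of_nat_mult by linarith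
qed

lemma chain_params_neg: "chain_params (- int (q - I + q * l)) (J - int p - int p * int l)"
proof -
  have "int p * int l \<le> int q * int l" using p_le by (intro mult_right_mono) auto
  moreover have "0 \<le> int p * int l" by simp
  moreover have "0 \<le> int q * int l" by simp
  moreover have "int (q - I) = int q - int I" "int I < int q" using I_less [OF k_less] by auto
  ultimately show ?thesis
    using J_bounds unfolding chain_params_def of_nat_add of_nat_mult by linarith
qed

lemma pos_dominant_params_interior:
  "pos_dominant_params p q (k / q) i j \<longleftrightarrow> i = int I \<and> j = J"
proof -
  have \<rho>: "real k / q \<noteq> 0" "real k / q \<noteq> 1" using k_pos k_less by auto
  have I: "int I > 0" "chain_params (int I) J" using I_pos chain_params_pos [of 0] by auto
  have least: "int I \<le> i'" if "i' > 0" "i' * int p = int k + j' * int q" for i' j'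
  proof (rule ccontr)
    assume "\<not> int I \<le> i'"
    then have "int I - i' > 0" "int I - i' < int q" using that(1) I_le by auto
    moreover have "int q dvd int I - i'"
      using base_line_cong [OF that(2)] dvd_diff_commute by metis
    ultimately show False by (meson zdvd_not_zless)
  qed
  show ?thesis
    unfolding pos_dominant_params_def base_point_in_chain_iff if_not_P [OF \<rho>(1)] if_not_P [OF \<rho>(2)]
  proof (intro iffI; elim conjE)
    assume i: "0 < i" "i * int p = int k + j * int q"
      and min: "\<forall>i' j'. i' > 0 \<and> chain_params i' j' \<and> i' * int p = int k + j' * int q \<longrightarrow> i \<le> i'"
    have "i \<le> int I" using min I IJ by metis
    then have "i = int I" using least [OF i] by linarith
    then show "i = int I \<and> j = J" using i(2) J_unique by simp
  next
    assume "i = int I" "j = J"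
    then show "0 < i \<and> chain_params i j \<and> i * int p = int k + j * int q \<and>
      (\<forall>i' j'. i' > 0 \<and> chain_params i' j' \<and> i' * int p = int k + j' * int q \<longrightarrow> i \<le> i')"
      using I IJ by (auto intro: least)
  qed
qed

lemma neg_dominant_params_interior:
  "neg_dominant_params p q (k / q) i j \<longleftrightarrow> i = int I - int q \<and> j = J - int p"
proof -
  have \<rho>: "real k / q \<noteq> 0" "real k / q \<noteq> 1" using k_pos k_less by auto
  have I: "int I - int q < 0" "chain_params (int I - int q) (J - int p)"
    using I_less [OF k_less] I_le chain_params_neg [of 0] by (auto simp: of_nat_diff)
  have IJ': "(int I - int q) * int p = int k + (J - int p) * int q"
    using IJ by (simp add: algebra_simps)
  have least: "i' \<le> int I - int q" if "i' < 0" "i' * int p = int k + j' * int q" for i' j'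
  proof (rule ccontr)
    assume "\<not> i' \<le> int I - int q"
    then have "int I - i' > 0" "int I - i' < int q" using that(1) I_pos by auto
    moreover have "int q dvd int I - i'"
      using base_line_cong [OF that(2)] dvd_diff_commute by metis
    ultimately show False by (meson zdvd_not_zless)
  qed
  have unique: "j' = J - int p" if "(int I - int q) * int p = int k + j' * int q" for j'
    using J_unique [of "j' + int p"] that by (simp add: algebra_simps)
  show ?thesis
    unfolding neg_dominant_params_def base_point_in_chain_iff if_not_P [OF \<rho>(1)] if_not_P [OF \<rho>(2)]
  proof (intro iffI; elim conjE)
    assume i: "i < 0" "i * int p = int k + j * int q"
      and min: "\<forall>i' j'. i' < 0 \<and> chain_params i' j' \<and> i' * int p = int k + j' * int q \<longrightarrow> - i \<le> - i'"
    have "- i \<le> - (int I - int q)" using min I IJ' by metis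
    then have "i = int I - int q" using least [OF i] by linarith
    then show "i = int I - int q \<and> j = J - int p" using i(2) unique by simp
  next
    assume "i = int I - int q" "j = J - int p"
    then show "i < 0 \<and> chain_params i j \<and> i * int p = int k + j * int q \<and>
      (\<forall>i' j'. i' < 0 \<and> chain_params i' j' \<and> i' * int p = int k + j' * int q \<longrightarrow> - i \<le> - i')"
      using I IJ' least by (simp only: neg_le_iff_le) blast
  qed
qed

end

text \<open>In the interior this is the minimality of I; on the boundary, \<open>J_0\<close> and
  \<open>J_q\<close> show that (I, J) is the pair fixed by convention.\<close>

lemma pos_dominant_params_iff:
  "pos_dominant_params p q (k / q) i j \<longleftrightarrow> i = int I \<and> j = J"
proof -
  consider "k = 0" | "k = q" | "0 < k" "k < q" using k_le by linarith
  then show ?thesis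
    by cases (use J_0 J_q I_0 I_q q_pos pos_dominant_params_interior in
      \<open>auto simp: pos_dominant_params_def\<close>)
qed

lemma neg_dominant_params_iff:
  "neg_dominant_params p q (k / q) i j \<longleftrightarrow> i = int I - int q \<and> j = J - int p"
proof -
  consider "k = 0" | "k = q" | "0 < k" "k < q" using k_le by linarith
  then show ?thesis
    by cases (use J_0 J_q I_0 I_q q_pos neg_dominant_params_interior in
      \<open>auto simp: neg_dominant_params_def\<close>)
qed

section \<open>Words of adjacent curves\<close>

lemma chain_through_pos_iff:
  "\<sigma> \<in> {QI, QIII} \<Longrightarrow> chain_through p q (k / q) \<sigma> l i j \<longleftrightarrow>
    chain_params i j \<and> i = int (I + q * l) \<and> j = J + int p * int l"
  by (auto simp: chain_through_def pos_dominant_params_iff)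

lemma chain_through_neg_iff:
  "\<sigma> \<in> {QII, QIV} \<Longrightarrow> chain_through p q (k / q) \<sigma> l i j \<longleftrightarrow>
    chain_params i j \<and> i = - int (q - I + q * l) \<and> j = J - int p - int p * int l"
  using I_le by (auto simp: chain_through_def neg_dominant_params_iff of_nat_diff)

text \<open>Words on the l-th chains have length at most q (l + 1). Within this distance of p/q,
  even that many steps accumulate a displacement below the grid step 1/q.\<close>

definition radius :: "nat \<Rightarrow> real" where
  "radius l = 1 / real q / real (q * (l + 1))"

lemma length_bound_pos: "0 < real (q * (l + 1))"
  unfolding of_nat_0_less_iff using q_pos by simp

lemma radius_pos: "0 < radius l"
  unfolding radius_def using q_pos length_bound_pos by (intro divide_pos_pos) auto

lemma radius_small:
  assumes "\<bar>\<theta> - p / q\<bar> < radius l"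
  shows "real (q * (l + 1)) * \<bar>\<theta> - p / q\<bar> < 1 / q"
  using assms length_bound_pos unfolding radius_def by (simp only: pos_less_divide_eq mult.commute)

text \<open>The curve has points on its side arbitrarily close to the base point. A single one
  within \<open>radius l\<close> reveals the word of the whole curve.\<close>

lemma adjacent_curve_obtain:
  assumes "adjacent_curve p q \<rho> \<sigma> l C w"
  obtains i j \<theta> \<rho>' where "chain_through p q \<rho> \<sigma> l i j" "(\<theta>, \<rho>') \<in> chain i j"
    "critical_word i (\<theta>, \<rho>') = w" "on_side p q \<sigma> (\<theta>, \<rho>')"
    "real (q * (l + 1)) * \<bar>\<theta> - p / q\<bar> < 1 / q"
proof -
  from assms obtain i j where ij: "chain_through p q \<rho> \<sigma> l i j" "critical_curve i j C w"
    and near: "\<forall>\<epsilon>>0. \<exists>x\<in>C. dist x (base_point p q \<rho>) < \<epsilon> \<and> on_side p q \<sigma> x"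
    by (auto simp: adjacent_curve_def)
  obtain x where x: "x \<in> C" "dist x (base_point p q \<rho>) < radius l" "on_side p q \<sigma> x"
    using near radius_pos by blast
  obtain \<theta> \<rho>' where x_eq: "x = (\<theta>, \<rho>')" by (cases x)
  have "\<bar>\<theta> - p / q\<bar> \<le> dist x (base_point p q \<rho>)"
    using dist_fst_le [of x "base_point p q \<rho>"] by (simp add: x_eq base_point_def dist_real_def)
  then have "\<bar>\<theta> - p / q\<bar> < radius l" using x(2) by linarith
  then have "real (q * (l + 1)) * \<bar>\<theta> - p / q\<bar> < 1 / q" by (rule radius_small)
  moreover have "C \<subseteq> level_set i j w"
    using ij by (auto simp: critical_curve_def dest: in_components_subset)
  ultimately show thesis using that ij(1) x x_eq by (auto simp: level_set_def)
qed

lemma small_mono: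
  assumes "N \<le> q * (l + 1)" "real (q * (l + 1)) * \<bar>d\<bar> < 1 / q"
  shows "real N * \<bar>d\<bar> < 1 / q"
proof -
  have "real N * \<bar>d\<bar> \<le> real (q * (l + 1)) * \<bar>d\<bar>"
    using assms(1) by (intro mult_right_mono) (auto simp only: of_nat_le_iff abs_ge_zero)
  then show ?thesis using assms(2) by linarith
qed

lemma length_bounds: "I + q * l \<le> q * (l + 1)" "q - I + q * l \<le> q * (l + 1)"
  using I_le by (auto simp: algebra_simps)

lemma adjacent_curve_word:
  assumes "adjacent_curve p q (k / q) \<sigma> l C w"
  shows "w = (case \<sigma> of
      QI \<Rightarrow> u_plus @ word_power (switch_first u_minus @ u_plus) l
    | QII \<Rightarrow> u_minus @ word_power (u_plus @ switch_first u_minus) l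
    | QIII \<Rightarrow> u_plus @ word_power (u_minus @ switch_first u_plus) l
    | QIV \<Rightarrow> u_minus @ word_power (switch_first u_plus @ u_minus) l)"
proof -
  obtain i j \<theta> \<rho> where *: "chain_through p q (k / q) \<sigma> l i j" "(\<theta>, \<rho>) \<in> chain i j"
    "critical_word i (\<theta>, \<rho>) = w" "on_side p q \<sigma> (\<theta>, \<rho>)"
    and small: "real (q * (l + 1)) * \<bar>\<theta> - p / q\<bar> < 1 / q"
    using adjacent_curve_obtain [OF assms] .
  note small' = small_mono [OF length_bounds(1) small] small_mono [OF length_bounds(2) small]
  have pos: "i = int (I + q * l)" "(\<theta>, \<rho>) \<in> pos_chain l" if "\<sigma> \<in> {QI, QIII}"
    using * chain_through_pos_iff [OF that] by auto
  have neg: "i = - int (q - I + q * l)" "(\<theta>, \<rho>) \<in> neg_chain l" if "\<sigma> \<in> {QII, QIV}"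
    using * chain_through_neg_iff [OF that] by auto
  show ?thesis
  proof (cases \<sigma>)
    case QI
    then show ?thesis using pos *(3,4) word_I [OF _ small'(1)] by (simp add: on_side_def)
  next
    case QII
    then show ?thesis using neg *(3,4) word_II [OF _ small'(2)] by (simp add: on_side_def)
  next
    case QIII
    then show ?thesis using pos *(3,4) word_III [OF _ small'(1)] by (simp add: on_side_def)
  next
    case QIV
    then show ?thesis using neg *(3,4) word_IV [OF _ small'(2)] by (simp add: on_side_def)
  qed
qed

text \<open>In III and IV a chain of nonzero slope would have \<rho> < 0. The exception comes from
  the segment \<rho> = 0 itself, the 0th positive chain, which may also extend to the left of the
  base point.\<close>

lemma adjacent_curve_side_0:
  assumes "adjacent_curve p q 0 \<sigma> l C w" and "k = 0"
  shows "\<sigma> \<in> {QI, QII} \<or> (\<sigma> = QIII \<and> l = 0)"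
proof -
  have "adjacent_curve p q (k / q) \<sigma> l C w" using assms by simp
  then obtain i j \<theta> \<rho> where *: "chain_through p q (k / q) \<sigma> l i j" "(\<theta>, \<rho>) \<in> chain i j"
    "on_side p q \<sigma> (\<theta>, \<rho>)"
    using adjacent_curve_obtain by metis
  have "I = 0" using assms(2) I_0 by simp
  show ?thesis
  proof (cases \<sigma>)
    case QIII
    then have "0 \<le> real (I + q * l) * (\<theta> - p / q)" and "\<theta> < p / q"
      using * chain_through_pos_iff [of QIII l i j] pos_chain_iff [of \<theta> \<rho> l] assms(2)
      by (auto simp: on_side_def)
    then have "I + q * l = 0"
      by (simp add: zero_le_mult_iff del: of_nat_add of_nat_mult)
    then show ?thesis using QIII q_pos by simp
  next
    case QIV
    then have "real (q - I + q * l) * (\<theta> - p / q) \<le> 0" and "p / q < \<theta>"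
      using * chain_through_neg_iff [of QIV l i j] neg_chain_iff [of \<theta> \<rho> l] assms(2)
      by (auto simp: on_side_def)
    then have "q - I + q * l = 0"
      by (simp add: mult_le_0_iff del: of_nat_add of_nat_mult)
    then show ?thesis using \<open>I = 0\<close> q_pos by simp
  qed auto
qed

text \<open>The mirror image: the exception is the segment \<rho> = 1, the 0th negative chain, to
  the left of the base point.\<close>

lemma adjacent_curve_side_1:
  assumes "adjacent_curve p q 1 \<sigma> l C w" and "k = q"
  shows "\<sigma> \<in> {QIII, QIV} \<or> (\<sigma> = QII \<and> l = 0)"
proof -
  have "adjacent_curve p q (k / q) \<sigma> l C w" using assms q_pos by simp
  then obtain i j \<theta> \<rho> where *: "chain_through p q (k / q) \<sigma> l i j" "(\<theta>, \<rho>) \<in> chain i j"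
    "on_side p q \<sigma> (\<theta>, \<rho>)"
    using adjacent_curve_obtain by metis
  have "I = q" using assms(2) I_q by simp
  have one: "real k / q = 1" using assms(2) q_pos by simp
  show ?thesis
  proof (cases \<sigma>)
    case QI
    then have "real (I + q * l) * (\<theta> - p / q) \<le> 0" and "p / q < \<theta>"
      using * chain_through_pos_iff [of QI l i j] pos_chain_iff [of \<theta> \<rho> l] one
      by (auto simp: on_side_def)
    then have "I + q * l = 0"
      by (simp add: mult_le_0_iff del: of_nat_add of_nat_mult)
    then show ?thesis using \<open>I = q\<close> q_pos by simp
  next
    case QII
    then have "0 \<le> real (q - I + q * l) * (\<theta> - p / q)" and "\<theta> < p / q"
      using * chain_through_neg_iff [of QII l i j] neg_chain_iff [of \<theta> \<rho> l] one
      by (auto simp: on_side_def)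
    then have "q - I + q * l = 0"
      by (simp add: zero_le_mult_iff del: of_nat_add of_nat_mult)
    then show ?thesis using QII q_pos by simp
  qed auto
qed

section \<open>Existence of curves at interior base points\<close>

context
  assumes k_pos: "0 < k" and k_less: "k < q"
begin

lemma grid_interior:
  assumes "0 < m" "m < q" "\<bar>e\<bar> < 1 / q"
  shows "real m / q + e \<in> {0..1}"
  using grid_less_iff [of q 0 e 0 m] grid_less_iff [of q e 0 m q] assms q_pos by auto

lemma near_theta:
  assumes "\<bar>\<theta> - p / q\<bar> < radius l"
  shows "\<theta> \<in> {0..1}"
proof -
  have "1 \<le> q * (l + 1)" using q_pos by (simp add: Suc_le_eq)
  then have "real 1 * \<bar>\<theta> - p / q\<bar> < 1 / q"
    using small_mono radius_small [OF assms] by blast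
  then show ?thesis
    using grid_interior [of p "\<theta> - p / q"] p_pos p_less k_pos k_less by simp
qed

lemma near_pos_chain:
  assumes "\<bar>\<theta> - p / q\<bar> < radius l"
  shows "(\<theta>, of_int (int (I + q * l)) * \<theta> - of_int (J + int p * int l)) \<in> pos_chain l"
proof -
  have "\<bar>real (I + q * l) * (\<theta> - p / q)\<bar> < 1 / q"
    using small_mono [OF length_bounds(1) radius_small [OF assms]] by (simp add: abs_mult)
  then show ?thesis
    unfolding pos_chain_iff of_int_of_nat_eq
    using grid_interior [OF k_pos k_less] near_theta [OF assms] pos_line by simp
qed

lemma near_neg_chain:
  assumes "\<bar>\<theta> - p / q\<bar> < radius l"
  shows "(\<theta>, of_int (- int (q - I + q * l)) * \<theta> - of_int (J - int p - int p * int l)) \<in> neg_chain l"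
proof -
  have "\<bar>- (real (q - I + q * l) * (\<theta> - p / q))\<bar> < 1 / q"
    using small_mono [OF length_bounds(2) radius_small [OF assms]] by (simp add: abs_mult)
  then show ?thesis
    unfolding neg_chain_iff of_int_minus of_int_of_nat_eq
    using grid_interior [OF k_pos k_less, of "- (real (q - I + q * l) * (\<theta> - p / q))"]
      near_theta [OF assms] neg_line by simp
qed

text \<open>The segment leaves out the base point: for l > 0 the orbit there meets its target after
  only I, respectively q - I, steps. The base point then has a shorter word and is merely in the
  closure of the curve.\<close>

lemma adjacent_curveI:
  assumes "chain_through p q (k / q) \<sigma> l i j" and "real_of_int i * (p / q) - of_int j = k / q"
    and level: "\<And>\<theta>. \<bar>\<theta> - p / q\<bar> < radius l \<Longrightarrow> on_side p q \<sigma> (\<theta>, of_int i * \<theta> - of_int j)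
      \<Longrightarrow> (\<theta>, of_int i * \<theta> - of_int j) \<in> level_set i j w"
  shows "\<exists>C w. adjacent_curve p q (k / q) \<sigma> l C w"
proof -
  define s :: real where "s = (if \<sigma> = QI \<or> \<sigma> = QIV then 1 else -1)"
  \<comment> \<open>A parametrization of the line leading away from the base point, with s chosen so
    that t > 0 is the side of the quadrant.\<close>
  define g where "g t = (p / q + s * t, of_int i * (p / q + s * t) - of_int j)" for t :: real
  let ?r = "radius l"
  have side: "on_side p q \<sigma> (g t)" if "0 < t" for t
    using that by (simp add: on_side_def g_def s_def)
  have lev: "g ` {0<..<?r} \<subseteq> level_set i j w"
    using level side by (auto simp: g_def s_def)
  have cont: "continuous_on UNIV g"
    unfolding g_def by (intro continuous_intros)
  then have conn: "connected (g ` {0<..<?r})"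
    by (intro connected_continuous_image) (auto intro: continuous_on_subset)
  have "g (?r / 2) \<noteq> g (?r / 3)" using radius_pos [of l] by (auto simp: g_def s_def)
  moreover have "g (?r / 2) \<in> g ` {0<..<?r}" "g (?r / 3) \<in> g ` {0<..<?r}"
    using radius_pos [of l] by auto
  moreover have "chain_params i j" using assms(1) by (simp add: chain_through_def)
  ultimately obtain C where C: "critical_curve i j C w" "g ` {0<..<?r} \<subseteq> C"
    using critical_curve_superset [OF _ lev conn] by blast
  have near: "\<exists>x\<in>C. dist x (base_point p q (k / q)) < \<epsilon> \<and> on_side p q \<sigma> x" if "\<epsilon> > 0" for \<epsilon>
  proof -
    have "isCont g 0" using cont by (simp add: continuous_on_eq_continuous_at)
    then obtain d where d: "d > 0" "\<And>t. dist t 0 < d \<Longrightarrow> dist (g t) (g 0) < \<epsilon>"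
      using \<open>\<epsilon> > 0\<close> unfolding continuous_at_eps_delta by blast
    define t where "t = min (d / 2) (?r / 2)"
    have "0 < t" "t < ?r" "dist t 0 < d" using d(1) radius_pos [of l] by (auto simp: t_def)
    moreover have "g 0 = base_point p q (k / q)" using assms(2) by (simp add: g_def base_point_def)
    moreover have "g t \<in> C" using C(2) \<open>0 < t\<close> \<open>t < ?r\<close> by auto
    ultimately show ?thesis using d(2) [of t] side [of t] by auto
  qed
  then have "base_point p q (k / q) \<in> closure C" by (meson closure_approachable)
  then have "adjacent_curve p q (k / q) \<sigma> l C w"
    using C(1) assms(1) near by (auto simp: adjacent_curve_def)
  then show ?thesis by blast
qed

lemma base_on_line:
  "real_of_int (int (I + q * l)) * (p / q) - of_int (J + int p * int l) = k / q"
  "real_of_int (- int (q - I + q * l)) * (p / q) - of_int (J - int p - int p * int l) = k / q"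
  using pos_line [of l "p / q"] neg_line [of l "p / q"] by simp_all

lemma adjacent_curve_exists: "\<exists>C w. adjacent_curve p q (k / q) \<sigma> l C w"
proof -
  have small: "real (I + q * l) * \<bar>\<theta> - p / q\<bar> < 1 / q" "real (q - I + q * l) * \<bar>\<theta> - p / q\<bar> < 1 / q"
    if "\<bar>\<theta> - p / q\<bar> < radius l" for \<theta>
    using small_mono [OF _ radius_small [OF that]] length_bounds by blast+
  note pos = adjacent_curveI [OF _ base_on_line(1)] and neg = adjacent_curveI [OF _ base_on_line(2)]
  have *: "chain_through p q (k / q) \<sigma> l (int (I + q * l)) (J + int p * int l)" if "\<sigma> \<in> {QI, QIII}"
    using chain_through_pos_iff [OF that] chain_params_pos k_pos k_less by blast
  have **: "chain_through p q (k / q) \<sigma> l (- int (q - I + q * l)) (J - int p - int p * int l)"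
    if "\<sigma> \<in> {QII, QIV}"
    using chain_through_neg_iff [OF that] chain_params_neg k_pos k_less by blast
  show ?thesis
  proof (cases \<sigma>)
    case QI
    show ?thesis
    proof (rule pos [OF *])
      fix \<theta> :: real
      assume near: "\<bar>\<theta> - p / q\<bar> < radius l" and "on_side p q \<sigma> (\<theta>, of_int (int (I + q * l)) * \<theta> - of_int (J + int p * int l))"
      then have "p / q < \<theta>" using QI by (simp add: on_side_def)
      then show "(\<theta>, of_int (int (I + q * l)) * \<theta> - of_int (J + int p * int l))
        \<in> level_set (int (I + q * l)) (J + int p * int l) (u_plus @ word_power (switch_first u_minus @ u_plus) l)"
        using word_I [OF near_pos_chain [OF near] small(1) [OF near]] near_pos_chain [OF near]
        unfolding level_set_def by blast
    qed (use QI in simp)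
  next
    case QII
    show ?thesis
    proof (rule neg [OF **])
      fix \<theta> :: real
      assume near: "\<bar>\<theta> - p / q\<bar> < radius l" and "on_side p q \<sigma> (\<theta>, of_int (- int (q - I + q * l)) * \<theta> - of_int (J - int p - int p * int l))"
      then have "\<theta> < p / q" using QII by (simp add: on_side_def)
      then show "(\<theta>, of_int (- int (q - I + q * l)) * \<theta> - of_int (J - int p - int p * int l))
        \<in> level_set (- int (q - I + q * l)) (J - int p - int p * int l)
          (u_minus @ word_power (u_plus @ switch_first u_minus) l)"
        using word_II [OF near_neg_chain [OF near] small(2) [OF near]] near_neg_chain [OF near]
        unfolding level_set_def by blast
    qed (use QII in simp)
  next
    case QIII
    show ?thesis
    proof (rule pos [OF *])
      fix \<theta> :: real
      assume near: "\<bar>\<theta> - p / q\<bar> < radius l" and "on_side p q \<sigma> (\<theta>, of_int (int (I + q * l)) * \<theta> - of_int (J + int p * int l))"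
      then have "\<theta> < p / q" using QIII by (simp add: on_side_def)
      then show "(\<theta>, of_int (int (I + q * l)) * \<theta> - of_int (J + int p * int l))
        \<in> level_set (int (I + q * l)) (J + int p * int l) (u_plus @ word_power (u_minus @ switch_first u_plus) l)"
        using word_III [OF near_pos_chain [OF near] small(1) [OF near]] near_pos_chain [OF near]
        unfolding level_set_def by blast
    qed (use QIII in simp)
  next
    case QIV
    show ?thesis
    proof (rule neg [OF **])
      fix \<theta> :: real
      assume near: "\<bar>\<theta> - p / q\<bar> < radius l" and "on_side p q \<sigma> (\<theta>, of_int (- int (q - I + q * l)) * \<theta> - of_int (J - int p - int p * int l))"
      then have "p / q < \<theta>" using QIV by (simp add: on_side_def)
      then show "(\<theta>, of_int (- int (q - I + q * l)) * \<theta> - of_int (J - int p - int p * int l))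
        \<in> level_set (- int (q - I + q * l)) (J - int p - int p * int l)
          (u_minus @ word_power (switch_first u_plus @ u_minus) l)"
        using word_IV [OF near_neg_chain [OF near] small(2) [OF near]] near_neg_chain [OF near]
        unfolding level_set_def by blast
    qed (use QIV in simp)
  qed
qed

text \<open>Here the level set is known on both sides and at the centre, so the curve contains the
  base point.\<close>

lemma dominant_curve_exists:
  assumes "chain_params i j" and base: "real_of_int i * (p / q) - of_int j = k / q"
    and level: "\<And>\<theta>. \<bar>\<theta> - p / q\<bar> < radius 0 \<Longrightarrow>
      (\<theta>, of_int i * \<theta> - of_int j) \<in> level_set i j w"
  obtains C where "critical_curve i j C w" "base_point p q (k / q) \<in> C"
proof -
  define g where "g \<theta> = (\<theta>, of_int i * \<theta> - of_int j)" for \<theta> :: real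
  define A where "A = ball (real p / q) (radius 0)"
  have "g ` A \<subseteq> level_set i j w"
    using level by (auto simp: g_def A_def dist_real_def abs_minus_commute)
  moreover have "connected (g ` A)"
    unfolding A_def g_def by (intro connected_continuous_image continuous_intros) (simp add: convex_connected)
  moreover have "g (p / q) \<in> g ` A" "g (p / q + radius 0 / 2) \<in> g ` A"
    using radius_pos [of 0] by (auto simp: A_def dist_real_def)
  moreover have "g (p / q) \<noteq> g (p / q + radius 0 / 2)" using radius_pos [of 0] by (simp add: g_def)
  ultimately obtain C where "critical_curve i j C w" "g ` A \<subseteq> C"
    using critical_curve_superset [OF assms(1)] by metis
  moreover have "g (p / q) = base_point p q (k / q)" using base by (simp add: g_def base_point_def)
  ultimately show thesis using that \<open>g (p / q) \<in> g ` A\<close> by (metis subsetD)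
qed

end

end

text \<open>Makes the definite description of a dominant word meaningful. Components of one level
  set that meet are equal, so a nondegenerate curve through \<zeta> excludes {\<zeta>} as a
  component. Then D also contains \<zeta>, and the word at \<zeta> is unique.\<close>

lemma dominant_on_chain_unique:
  assumes "critical_curve i j C u" "\<zeta> \<in> C" and "dominant_on_chain i j \<zeta> D w"
  shows "w = u"
proof -
  have u: "critical_word i \<zeta> = u" "\<zeta> \<in> level_set i j u"
    using assms(1,2) in_components_subset by (fastforce simp: critical_curve_def level_set_def)+
  have "\<not> farey_point i j \<zeta>"
  proof
    assume "farey_point i j \<zeta>"
    then obtain w' where w': "{\<zeta>} \<in> components (level_set i j w')" by (auto simp: farey_point_def)
    then have "\<zeta> \<in> level_set i j w'" using in_components_subset by blast
    then have "w' = u" using u by (simp add: level_set_def)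
    then have "C = {\<zeta>}"
      using w' assms(1,2) components_eq [of C "level_set i j u" "{\<zeta>}"] by (auto simp: critical_curve_def)
    then show False using assms(1) by (simp add: critical_curve_def)
  qed
  then have "\<zeta> \<in> D" "critical_curve i j D w" using assms(3) by (auto simp: dominant_on_chain_def)
  then show ?thesis
    using u(1) in_components_subset by (fastforce simp: critical_curve_def level_set_def)
qed

section \<open>Identification of the dominant words\<close>

context critical_parameters
begin

lemma pos_dominant_word_eq: "pos_dominant_word p q (k / q) = u_plus"
proof -
  consider "k = 0" | "k = q" | "0 < k" "k < q" using k_le by linarith
  then show ?thesis
  proof cases
    case 1
    then show ?thesis using I_0 u_plus_def by (simp add: pos_dominant_word_def)
  next
    case 2
    then have "I = q" using I_q by simp
    then have "u_plus = map (\<lambda>n. La) [0..<q]"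
      unfolding u_plus_def using 2 residue_less by (intro map_cong) (auto simp: letter_of_def)
    then show ?thesis using 2 q_pos by (simp add: pos_dominant_word_def map_replicate_const)
  next
    case 3
    \<comment> \<open>For l = 0 the powers are empty, so the words to the left, to the right and at
      the base point coincide.\<close>
    have level: "(\<theta>, of_int (int I) * \<theta> - of_int J) \<in> level_set (int I) J u_plus"
      if near: "\<bar>\<theta> - p / q\<bar> < radius 0" for \<theta>
    proof -
      have c: "(\<theta>, of_int (int I) * \<theta> - of_int J) \<in> pos_chain 0"
        using near_pos_chain [OF 3 near] by simp
      have small: "real (I + q * 0) * \<bar>\<theta> - p / q\<bar> < 1 / q"
        using small_mono [OF length_bounds(1) radius_small [OF near]] .
      have "critical_word (int I) (\<theta>, of_int (int I) * \<theta> - of_int J) = u_plus"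
      proof (cases \<theta> "real p / real q" rule: linorder_cases)
        case less
        then show ?thesis using word_III [OF c small] by simp
      next
        case equal
        show ?thesis unfolding equal by (rule word_base_pos [OF 3 c [unfolded equal]])
      next
        case greater
        then show ?thesis using word_I [OF c small] by simp
      qed
      then show ?thesis using c by (simp add: level_set_def)
    qed
    have params: "chain_params (int I) J" using chain_params_pos [OF 3, of 0] by simp
    have base: "real_of_int (int I) * (p / q) - of_int J = k / q"
      using base_on_line(1) [OF 3, of 0] by simp
    obtain C where C: "critical_curve (int I) J C u_plus" "base_point p q (k / q) \<in> C"
      by (rule dominant_curve_exists [OF 3 params base level])
    have "(THE w. \<exists>i j C. pos_dominant_params p q (k / q) i j \<and>
        dominant_on_chain i j (base_point p q (k / q)) C w) = u_plus"
      unfolding pos_dominant_params_iff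
    proof (rule the_equality)
      fix w
      assume "\<exists>i j C. (i = int I \<and> j = J) \<and> dominant_on_chain i j (base_point p q (k / q)) C w"
      then show "w = u_plus" using dominant_on_chain_unique [OF C] by blast
    qed (use C in \<open>auto simp only: dominant_on_chain_def\<close>)
    then show ?thesis using 3 by (simp add: pos_dominant_word_def)
  qed
qed

lemma neg_dominant_word_eq: "neg_dominant_word p q (k / q) = u_minus"
proof -
  consider "k = 0" | "k = q" | "0 < k" "k < q" using k_le by linarith
  then show ?thesis
  proof cases
    case 1
    then have "I = 0" using I_0 by simp
    then have "u_minus = map (\<lambda>n. Lb) [0..<q]"
      unfolding u_minus_def using 1 by (intro map_cong) (auto simp: letter_of_def)
    then show ?thesis using 1 by (simp add: neg_dominant_word_def map_replicate_const)
  next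
    case 2
    then show ?thesis using I_q q_pos u_minus_def by (simp add: neg_dominant_word_def)
  next
    case 3
    let ?i = "- int (q - I)" and ?j = "J - int p"
    have level: "(\<theta>, of_int ?i * \<theta> - of_int ?j) \<in> level_set ?i ?j u_minus"
      if near: "\<bar>\<theta> - p / q\<bar> < radius 0" for \<theta>
    proof -
      have c: "(\<theta>, of_int ?i * \<theta> - of_int ?j) \<in> neg_chain 0"
        using near_neg_chain [OF 3 near] by simp
      have small: "real (q - I + q * 0) * \<bar>\<theta> - p / q\<bar> < 1 / q"
        using small_mono [OF length_bounds(2) radius_small [OF near]] .
      have "critical_word ?i (\<theta>, of_int ?i * \<theta> - of_int ?j) = u_minus"
      proof (cases \<theta> "real p / real q" rule: linorder_cases)
        case less
        then show ?thesis using word_II [OF c small] by simp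
      next
        case equal
        show ?thesis unfolding equal by (rule word_base_neg [OF 3 c [unfolded equal]])
      next
        case greater
        then show ?thesis using word_IV [OF c small] by simp
      qed
      then show ?thesis using c by (simp add: level_set_def)
    qed
    have params: "chain_params ?i ?j" using chain_params_neg [OF 3, of 0] by simp
    have base: "real_of_int ?i * (p / q) - of_int ?j = k / q"
      using base_on_line(2) [OF 3, of 0] by simp
    obtain C where C: "critical_curve ?i ?j C u_minus" "base_point p q (k / q) \<in> C"
      by (rule dominant_curve_exists [OF 3 params base level])
    have i: "int I - int q = ?i" using I_le by simp
    have "(THE w. \<exists>i j C. neg_dominant_params p q (k / q) i j \<and>
        dominant_on_chain i j (base_point p q (k / q)) C w) = u_minus"
      unfolding neg_dominant_params_iff i
    proof (rule the_equality)
      fix w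
      assume "\<exists>i j C. (i = ?i \<and> j = ?j) \<and> dominant_on_chain i j (base_point p q (k / q)) C w"
      then show "w = u_minus" using dominant_on_chain_unique [OF C] by blast
    qed (use C in \<open>auto simp only: dominant_on_chain_def\<close>)
    then show ?thesis using 3 by (simp add: neg_dominant_word_def)
  qed
qed

end

section \<open>Existence of the parameters and conclusion\<close>

lemma critical_parameters_exist:
  fixes p q k :: nat
  assumes "q > 0" "p \<le> q" "coprime p q" "k \<le> q"
  obtains I J where "critical_parameters p q k I J"
proof -
  consider "k = 0" | "k = q" | "0 < k" "k < q" using assms(4) by linarith
  then show thesis
  proof cases
    case 1
    then have "critical_parameters p q k 0 0" using assms by unfold_locales auto
    then show thesis by (rule that)
  next
    case 2
    \<comment> \<open>With I = k = q, the equation q p = q + J q forces J = p - 1.\<close>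
    then have "critical_parameters p q k q (int p - 1)"
      using assms by unfold_locales (auto simp: algebra_simps)
    then show thesis by (rule that)
  next
    case 3
    \<comment> \<open>The inverse x of p modulo q gives the solution I = x k mod q of I p = k modulo
      q.\<close>
    obtain x where "[p * x = Suc 0] (mod q)" using cong_solve_coprime_nat [OF assms(3)] by auto
    then have "[k * (p * x) = k * Suc 0] (mod q)" by (rule cong_scalar_left)
    then have "[(x * k) mod q * p = k] (mod q)"
      by (simp add: cong_def mod_mult_right_eq ac_simps)
    then have k: "((x * k) mod q * p) mod q = k" using 3 by (simp add: cong_def)
    define I where "I = (x * k) mod q"
    have "I * p = k + (I * p div q) * q" using k by (metis I_def add.commute div_mult_mod_eq)
    then have "int I * int p = int k + int (I * p div q) * int q" by (metis of_nat_add of_nat_mult)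
    moreover have "I < q" using assms(1) by (simp add: I_def)
    moreover have "I \<noteq> 0" using k 3 by (metis I_def less_irrefl mod_0 mult_0)
    ultimately have "critical_parameters p q k I (int (I * p div q))"
      using assms 3 by unfold_locales auto
    then show thesis by (rule that)
  qed
qed

theorem theorem6:
  fixes p q r s :: nat and \<rho> :: real and u_pos u_neg v_pos v_neg :: "letter list"
  assumes crit: "rational_critical_point p q r s"
    and rho: "\<rho> = real r / real s"
    and u_pos: "u_pos = pos_dominant_word p q \<rho>"
    and u_neg: "u_neg = neg_dominant_word p q \<rho>"
    and v_pos: "v_pos = switch_first u_pos"
    and v_neg: "v_neg = switch_first u_neg"
  shows "length (u_pos @ u_neg) = q \<and> length (u_neg @ u_pos) = q \<and>
    (\<forall>\<sigma> l C w. adjacent_curve p q \<rho> \<sigma> l C w \<longrightarrow>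
       w = (case \<sigma> of
              QI \<Rightarrow> u_pos @ word_power (v_neg @ u_pos) l
            | QII \<Rightarrow> u_neg @ word_power (u_pos @ v_neg) l
            | QIII \<Rightarrow> u_pos @ word_power (u_neg @ v_pos) l
            | QIV \<Rightarrow> u_neg @ word_power (v_pos @ u_neg) l)) \<and>
    (\<rho> \<noteq> 0 \<and> \<rho> \<noteq> 1 \<longrightarrow> (\<forall>\<sigma> l. \<exists>C w. adjacent_curve p q \<rho> \<sigma> l C w)) \<and>
    (\<rho> = 0 \<longrightarrow> (\<forall>\<sigma> l C w. adjacent_curve p q \<rho> \<sigma> l C w \<longrightarrow>
       \<sigma> \<in> {QI, QII} \<or> (\<sigma> = QIII \<and> l = 0))) \<and>
    (\<rho> = 1 \<longrightarrow> (\<forall>\<sigma> l C w. adjacent_curve p q \<rho> \<sigma> l C w \<longrightarrow>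
       \<sigma> \<in> {QIII, QIV} \<or> (\<sigma> = QII \<and> l = 0)))"
proof -
  have q: "q > 0" and s: "s > 0" and cop: "coprime p q" "coprime r s" and "s dvd q"
    and "real p / real q \<le> 1" "real r / real s \<le> 1"
    using crit by (auto simp: rational_critical_point_def critical_point_def)
  then have "p \<le> q" "r \<le> s" by auto
  \<comment> \<open>Since s divides q, the ordinate r/s is rewritten as (r m)/q, on the same grid as
    p/q.\<close>
  obtain m where m: "q = s * m" using \<open>s dvd q\<close> by blast
  define k where "k = r * m"
  have "k \<le> q" using \<open>r \<le> s\<close> by (simp add: k_def m)
  have \<rho>: "\<rho> = real k / real q" using q by (simp add: rho k_def m)
  obtain I J where "critical_parameters p q k I J"
    using critical_parameters_exist q \<open>p \<le> q\<close> cop(1) \<open>k \<le> q\<close> by blast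
  then interpret critical_parameters p q k I J .
  have u: "u_pos = u_plus" "u_neg = u_minus"
    using u_pos u_neg pos_dominant_word_eq neg_dominant_word_eq by (simp_all add: \<rho>)
  have interior: "0 < k" "k < q" if "\<rho> \<noteq> 0 \<and> \<rho> \<noteq> 1"
    using that \<open>k \<le> q\<close> q by (auto simp: \<rho>)
  have boundary: "\<rho> = 0 \<Longrightarrow> k = 0" "\<rho> = 1 \<Longrightarrow> k = q"
    using q by (auto simp: \<rho>)
  show ?thesis
    unfolding v_pos v_neg u
  proof (intro conjI allI impI)
    show "length (u_plus @ u_minus) = q" "length (u_minus @ u_plus) = q"
      using length_u by simp_all
  next
    fix \<sigma> l C w
    assume adj: "adjacent_curve p q \<rho> \<sigma> l C w"
    show "w = (case \<sigma> of
        QI \<Rightarrow> u_plus @ word_power (switch_first u_minus @ u_plus) l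
      | QII \<Rightarrow> u_minus @ word_power (u_plus @ switch_first u_minus) l
      | QIII \<Rightarrow> u_plus @ word_power (u_minus @ switch_first u_plus) l
      | QIV \<Rightarrow> u_minus @ word_power (switch_first u_plus @ u_minus) l)"
      using adj unfolding \<rho> by (rule adjacent_curve_word)
    show "\<sigma> \<in> {QI, QII} \<or> (\<sigma> = QIII \<and> l = 0)" if "\<rho> = 0"
      using adj boundary(1) [OF that] unfolding that by (rule adjacent_curve_side_0)
    show "\<sigma> \<in> {QIII, QIV} \<or> (\<sigma> = QII \<and> l = 0)" if "\<rho> = 1"
      using adj boundary(2) [OF that] unfolding that by (rule adjacent_curve_side_1)
  next
    fix \<sigma> l
    assume "\<rho> \<noteq> 0 \<and> \<rho> \<noteq> 1"
    note interior' = interior [OF this]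
    have "\<exists>C w. adjacent_curve p q (k / q) \<sigma> l C w"
      by (rule adjacent_curve_exists [OF interior'])
    then show "\<exists>C w. adjacent_curve p q \<rho> \<sigma> l C w" by (simp only: \<rho>)
  qed
qed

end
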